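(* Let $R$ be an arbitrary associative unitary ring, let $L:\mathrm{Mod}(R)\to \mathbb{R}_{\geq 0}\cup\{\infty\}$ be a length function, and let $M_\phi\in\mathrm{lFin}_L[X]$. Let $K=\bigcup_{n\in\mathbb{N}}\mathrm{Ker}(\phi^n)$ and denote by $\bar\phi:M/K\to M/K$ the (injective) map induced by $\phi$. Then $\mathrm{ent}_L(\phi)=\mathrm{ent}_L(\bar\phi)$.
   Context: $\mathrm{Mod}(R)$ is the category of right $R$-modules. A function $L:\mathrm{Mod}(R)\to \mathbb{R}_{\geq 0}\cup\{\infty\}$ is a length function if: $L(0)=0$ and $L(M)=L(M')$ whenever $M\cong M'$; $L(M)=L(M')+L(M'')$ for every short exact sequence $0\to M'\to M\to M''\to 0$ (additive); and $L(M)=\sup\{L(F): F \text{ a finitely generated submodule of } M\}$ for all $M$ (upper continuous). A module $N$ is $L$-finite if $L(N)<\infty$; $\mathrm{Fin}_L(M)$ is the set of $L$-finite submodules of $M$. A module is locally $L$-finite if all its finitely generated submodules are $L$-finite. $M_\phi$, with $M$ a right $R$-module and $\phi\in\mathrm{End}_R(M)$, denotes the right $R[X]$-module with underlying $R$-module $M$ on which $X$ acts as $\phi$. $\mathrm{lFin}_L[X]$ is the class of those $M_\phi$ with $M$ locally $L$-finite as an $R$-module. For $N\in\mathrm{Fin}_L(M)$ and $n\geq 1$ let $T_n(\phi,N)=\sum_{i=0}^{n-1}\phi^i(N)$ and $\mathrm{ent}_L(\phi,N)=\lim_{n\to\infty}L(T_n(\phi,N))/n$ (the limit exists and is finite). The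 algebraic $L$-entropy is $\mathrm{ent}_L(M_\phi)=\mathrm{ent}_L(\phi)=\sup\{\mathrm{ent}_L(\phi,N): N\in\mathrm{Fin}_L(M)\}$. *)

theory Defs
  imports "HOL-Algebra.Module" "HOL-Algebra.AbelCoset" "HOL-Library.Extended_Nonnegative_Real"
begin

text \<open>
  \<^locale>\<open>module\<close> is about modules over commutative rings. We reuse its record type and its
  \<^locale>\<open>submodule\<close> for right modules over an arbitrary unital ring: \<open>r \<odot>\<^bsub>M\<^esub> x\<close> stands for the
  right action \<open>x \<cdot> r\<close>, whence the order of the factors in \<open>smult_assoc\<close>. The fields \<open>mult\<close>
  and \<open>one\<close> of a module record carry no information.
\<close>

locale right_module = R?: ring R + M?: abelian_group M
  for R :: "'r ring" and M :: "('r, 'm) module" (structure) +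
  assumes smult_closed:
      "\<lbrakk>a \<in> carrier R; x \<in> carrier M\<rbrakk> \<Longrightarrow> a \<odot>\<^bsub>M\<^esub> x \<in> carrier M"
    and smult_add_scalar:
      "\<lbrakk>a \<in> carrier R; b \<in> carrier R; x \<in> carrier M\<rbrakk> \<Longrightarrow>
        (a \<oplus>\<^bsub>R\<^esub> b) \<odot>\<^bsub>M\<^esub> x = a \<odot>\<^bsub>M\<^esub> x \<oplus>\<^bsub>M\<^esub> b \<odot>\<^bsub>M\<^esub> x"
    and smult_add:
      "\<lbrakk>a \<in> carrier R; x \<in> carrier M; y \<in> carrier M\<rbrakk> \<Longrightarrow>
        a \<odot>\<^bsub>M\<^esub> (x \<oplus>\<^bsub>M\<^esub> y) = a \<odot>\<^bsub>M\<^esub> x \<oplus>\<^bsub>M\<^esub> a \<odot>\<^bsub>M\<^esub> y"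
    and smult_assoc:
      "\<lbrakk>a \<in> carrier R; b \<in> carrier R; x \<in> carrier M\<rbrakk> \<Longrightarrow>
        (a \<otimes>\<^bsub>R\<^esub> b) \<odot>\<^bsub>M\<^esub> x = b \<odot>\<^bsub>M\<^esub> (a \<odot>\<^bsub>M\<^esub> x)"
    and smult_one:
      "x \<in> carrier M \<Longrightarrow> \<one>\<^bsub>R\<^esub> \<odot>\<^bsub>M\<^esub> x = x"

definition rmod_hom :: "'r ring \<Rightarrow> ('r, 'm) module \<Rightarrow> ('r, 'n) module \<Rightarrow> ('m \<Rightarrow> 'n) set" where
  "rmod_hom R M N = {h \<in> carrier M \<rightarrow> carrier N.
     (\<forall>x\<in>carrier M. \<forall>y\<in>carrier M. h (x \<oplus>\<^bsub>M\<^esub> y) = h x \<oplus>\<^bsub>N\<^esub> h y) \<and>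
     (\<forall>a\<in>carrier R. \<forall>x\<in>carrier M. h (a \<odot>\<^bsub>M\<^esub> x) = a \<odot>\<^bsub>N\<^esub> h x)}"

abbreviation rmod_End :: "'r ring \<Rightarrow> ('r, 'm) module \<Rightarrow> ('m \<Rightarrow> 'm) set" where
  "rmod_End R M \<equiv> rmod_hom R M M"

definition rmod_iso :: "'r ring \<Rightarrow> ('r, 'm) module \<Rightarrow> ('r, 'n) module \<Rightarrow> bool" where
  "rmod_iso R M N \<longleftrightarrow> (\<exists>h\<in>rmod_hom R M N. bij_betw h (carrier M) (carrier N))"

definition short_exact ::
  "'r ring \<Rightarrow> ('r, 'a) module \<Rightarrow> ('a \<Rightarrow> 'b) \<Rightarrow> ('r, 'b) module \<Rightarrow> ('b \<Rightarrow> 'c) \<Rightarrow> ('r, 'c) module \<Rightarrow> bool"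
  where
  "short_exact R M' f M g M'' \<longleftrightarrow>
     f \<in> rmod_hom R M' M \<and> g \<in> rmod_hom R M M'' \<and>
     inj_on f (carrier M') \<and> f ` carrier M' = a_kernel M M'' g \<and> g ` carrier M = carrier M''"

abbreviation sub_of :: "('r, 'm) module \<Rightarrow> 'm set \<Rightarrow> ('r, 'm) module" where
  "sub_of M N \<equiv> M\<lparr>carrier := N\<rparr>"

definition rspan :: "'r ring \<Rightarrow> ('r, 'm) module \<Rightarrow> 'm set \<Rightarrow> 'm set" where
  "rspan R M S = \<Inter>{H. submodule H R M \<and> S \<subseteq> H}"

definition fg_submodules :: "'r ring \<Rightarrow> ('r, 'm) module \<Rightarrow> 'm set set" where
  "fg_submodules R M = {rspan R M S |S. finite S \<and> S \<subseteq> carrier M}"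

text \<open>
  The type \<open>'u\<close> plays the role of the universe: \<open>Mod(R)\<close> consists of the right \<open>R\<close>-modules whose
  carrier is a set of elements of \<open>'u\<close>. Only the values of \<open>L\<close> on right \<open>R\<close>-modules matter.
\<close>

definition length_function :: "'r ring \<Rightarrow> (('r, 'u) module \<Rightarrow> ennreal) \<Rightarrow> bool" where
  "length_function R L \<longleftrightarrow>
     (\<forall>Z. right_module R Z \<and> carrier Z = {\<zero>\<^bsub>Z\<^esub>} \<longrightarrow> L Z = 0) \<and>
     (\<forall>M M'. right_module R M \<and> right_module R M' \<and> rmod_iso R M M' \<longrightarrow> L M = L M') \<and>
     (\<forall>M' f M g M''. right_module R M' \<and> right_module R M \<and> right_module R M'' \<and>
        short_exact R M' f M g M'' \<longrightarrow> L M = L M' + L M'') \<and>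
     (\<forall>M. right_module R M \<longrightarrow> L M = (SUP F\<in>fg_submodules R M. L (sub_of M F)))"

text \<open>
  A quotient of a module with carrier in \<open>'u\<close> has cosets as elements, so its carrier lies in
  \<^typ>\<open>'u set\<close>. The length of a module \<open>Q\<close> with elements of an arbitrary type is by definition the
  length of any module over \<open>'u\<close> isomorphic to \<open>Q\<close>. By \<open>length_at_eq\<close> below it does not depend on the choice; such a module
  exists for quotients and their submodules by \<open>ex_copy\<close> and \<open>inj_on_coset_rep\<close>.
\<close>

definition length_at ::
  "'r ring \<Rightarrow> (('r, 'u) module \<Rightarrow> ennreal) \<Rightarrow> ('r, 'q) module \<Rightarrow> ennreal" where
  "length_at R L Q = L (SOME N. right_module R N \<and> rmod_iso R N Q)"

definition Fin_sub :: "'r ring \<Rightarrow> (('r, 'm) module \<Rightarrow> ennreal) \<Rightarrow> ('r, 'm) module \<Rightarrow> 'm set set" where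
  "Fin_sub R L M = {N. submodule N R M \<and> L (sub_of M N) < \<infinity>}"

definition locally_finite :: "'r ring \<Rightarrow> (('r, 'm) module \<Rightarrow> ennreal) \<Rightarrow> ('r, 'm) module \<Rightarrow> bool" where
  "locally_finite R L M \<longleftrightarrow> (\<forall>F\<in>fg_submodules R M. L (sub_of M F) < \<infinity>)"

text \<open>The right \<open>R[X]\<close>-module \<open>M\<^sub>\<phi>\<close> is given as the pair \<open>(M, \<phi>)\<close>.\<close>

definition lFinX ::
  "'r ring \<Rightarrow> (('r, 'm) module \<Rightarrow> ennreal) \<Rightarrow> (('r, 'm) module \<times> ('m \<Rightarrow> 'm)) set" where
  "lFinX R L = {(M, \<phi>). right_module R M \<and> \<phi> \<in> rmod_End R M \<and> locally_finite R L M}"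

text \<open>\<open>trajectory M \<phi> N n\<close> is \<open>T\<^sub>n(\<phi>, N)\<close>.\<close>

primrec trajectory :: "('r, 'm) module \<Rightarrow> ('m \<Rightarrow> 'm) \<Rightarrow> 'm set \<Rightarrow> nat \<Rightarrow> 'm set" where
  "trajectory M \<phi> N 0 = {\<zero>\<^bsub>M\<^esub>}"
| "trajectory M \<phi> N (Suc n) = trajectory M \<phi> N n <+>\<^bsub>M\<^esub> (\<phi> ^^ n) ` N"

definition ent_at ::
  "(('r, 'm) module \<Rightarrow> ennreal) \<Rightarrow> ('r, 'm) module \<Rightarrow> ('m \<Rightarrow> 'm) \<Rightarrow> 'm set \<Rightarrow> ennreal" where
  "ent_at L M \<phi> N = lim (\<lambda>n. L (sub_of M (trajectory M \<phi> N n)) / of_nat n)"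

definition ent ::
  "'r ring \<Rightarrow> (('r, 'm) module \<Rightarrow> ennreal) \<Rightarrow> ('r, 'm) module \<Rightarrow> ('m \<Rightarrow> 'm) \<Rightarrow> ennreal" where
  "ent R L M \<phi> = (SUP N\<in>Fin_sub R L M. ent_at L M \<phi> N)"

definition quot :: "('r, 'm) module \<Rightarrow> 'm set \<Rightarrow> ('r, 'm set) module" where
  "quot M K = \<lparr>carrier = a_rcosets\<^bsub>M\<^esub> K, mult = (\<lambda>_ _. K), one = K, zero = K, add = set_add M,
     smult = (\<lambda>a C. \<Union>x\<in>C. K +>\<^bsub>M\<^esub> (a \<odot>\<^bsub>M\<^esub> x))\<rparr>"

definition induced :: "('r, 'm) module \<Rightarrow> 'm set \<Rightarrow> ('m \<Rightarrow> 'm) \<Rightarrow> 'm set \<Rightarrow> 'm set" where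
  "induced M K \<phi> C = (\<Union>x\<in>C. K +>\<^bsub>M\<^esub> \<phi> x)"

definition hyperkernel :: "('r, 'm) module \<Rightarrow> ('m \<Rightarrow> 'm) \<Rightarrow> 'm set" where
  "hyperkernel M \<phi> = (\<Union>n. a_kernel M M (\<phi> ^^ n))"

lemma rmod_iso_sym:
  assumes "right_module R M" "rmod_iso R M N"
  shows "rmod_iso R N M"
proof -
  interpret right_module R M by fact
  obtain h where h: "h \<in> rmod_hom R M N" and b: "bij_betw h (carrier M) (carrier N)"
    using assms(2) unfolding rmod_iso_def by blast
  let ?g = "inv_into (carrier M) h"
  have bg: "bij_betw ?g (carrier N) (carrier M)" using b by (rule bij_betw_inv_into)
  have g1: "?g y \<in> carrier M" if "y \<in> carrier N" for y using bij_betwE[OF bg] that by blast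
  have hg: "h (?g y) = y" if "y \<in> carrier N" for y using b that by (simp add: bij_betw_inv_into_right)
  have gh: "?g (h x) = x" if "x \<in> carrier M" for x using b that by (simp add: bij_betw_inv_into_left)
  have "?g \<in> rmod_hom R N M"
    unfolding rmod_hom_def
  proof (intro CollectI conjI ballI)
    show "?g \<in> carrier N \<rightarrow> carrier M" using g1 by auto
    fix x y assume "x \<in> carrier N" "y \<in> carrier N"
    then show "?g (x \<oplus>\<^bsub>N\<^esub> y) = ?g x \<oplus>\<^bsub>M\<^esub> ?g y"
      using h g1 hg gh[of "?g x \<oplus>\<^bsub>M\<^esub> ?g y"] by (simp add: rmod_hom_def)
  next
    fix a x assume "a \<in> carrier R" "x \<in> carrier N"
    then show "?g (a \<odot>\<^bsub>N\<^esub> x) = a \<odot>\<^bsub>M\<^esub> ?g x"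
      using h g1 hg gh[of "a \<odot>\<^bsub>M\<^esub> ?g x"] smult_closed by (simp add: rmod_hom_def)
  qed
  then show ?thesis using bg unfolding rmod_iso_def by blast
qed

lemma rmod_iso_trans:
  assumes "rmod_iso R M N" "rmod_iso R N P"
  shows "rmod_iso R M P"
proof -
  obtain h k where h: "h \<in> rmod_hom R M N" "bij_betw h (carrier M) (carrier N)"
    and k: "k \<in> rmod_hom R N P" "bij_betw k (carrier N) (carrier P)"
    using assms unfolding rmod_iso_def by blast
  have "k \<circ> h \<in> rmod_hom R M P"
    using h(1) k(1) by (auto simp: rmod_hom_def Pi_iff)
  then show ?thesis using bij_betw_trans[OF h(2) k(2)] unfolding rmod_iso_def by blast
qed

lemma length_at_eq:
  fixes L :: "('r, 'u) module \<Rightarrow> ennreal"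
  assumes "length_function R L" "right_module R N" "rmod_iso R N Q"
  shows "length_at R L Q = L N"
proof -
  let ?N = "SOME N :: ('r, 'u) module. right_module R N \<and> rmod_iso R N Q"
  have *: "right_module R ?N \<and> rmod_iso R ?N Q"
    by (rule someI[of "\<lambda>N. right_module R N \<and> rmod_iso R N Q" N]) (use assms in auto)
  then have "rmod_iso R ?N N" using rmod_iso_trans rmod_iso_sym assms by metis
  then show ?thesis using * assms unfolding length_at_def length_function_def by blast
qed

lemma ex_copy:
  fixes Q :: "('r, 'q) module" and f :: "'q \<Rightarrow> 'u"
  assumes "right_module R Q" "inj_on f (carrier Q)"
  shows "\<exists>N :: ('r, 'u) module. right_module R N \<and> rmod_iso R N Q"
proof -
  interpret right_module R Q by fact
  let ?g = "inv_into (carrier Q) f"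
  define N :: "('r, 'u) module" where
    "N = \<lparr>carrier = f ` carrier Q, mult = undefined, one = undefined, zero = f \<zero>\<^bsub>Q\<^esub>,
      add = (\<lambda>x y. f (?g x \<oplus>\<^bsub>Q\<^esub> ?g y)), smult = (\<lambda>a x. f (a \<odot>\<^bsub>Q\<^esub> ?g x))\<rparr>"
  have gf: "?g (f x) = x" if "x \<in> carrier Q" for x using assms(2) that by simp
  have "right_module R N"
  proof (intro right_module.intro R.ring_axioms right_module_axioms.intro abelian_groupI)
    fix x assume "x \<in> carrier N"
    then obtain z where z: "z \<in> carrier Q" "x = f z" by (auto simp: N_def)
    show "\<exists>y\<in>carrier N. y \<oplus>\<^bsub>N\<^esub> x = \<zero>\<^bsub>N\<^esub>"
      using z by (intro bexI[of _ "f (\<ominus>\<^bsub>Q\<^esub> z)"]) (auto simp: N_def gf M.l_neg)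
  qed (auto simp: N_def gf M.a_ac smult_closed smult_add_scalar smult_add smult_assoc smult_one)
  moreover have "rmod_iso R N Q"
    unfolding rmod_iso_def
  proof
    show "bij_betw ?g (carrier N) (carrier Q)"
      using assms(2) by (simp add: N_def bij_betw_inv_into inj_on_imp_bij_betw)
    show "?g \<in> rmod_hom R N Q"
      by (auto simp: rmod_hom_def N_def gf smult_closed)
  qed
  ultimately show ?thesis by blast
qed

lemma inj_on_coset_rep:
  assumes "right_module R M" "submodule K R M"
  shows "inj_on (\<lambda>C. SOME x. x \<in> C) (carrier (quot M K))"
proof -
  interpret right_module R M by fact
  have K: "subgroup K (add_monoid M)" using assms(2) by (rule submodule.axioms)
  have ne: "(SOME x. x \<in> C) \<in> C" if C: "C \<in> a_rcosets\<^bsub>M\<^esub> K" for C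
  proof -
    obtain a where a: "a \<in> carrier M" "C = K +>\<^bsub>M\<^esub> a" using C by (auto simp: A_RCOSETS_def')
    then have "a \<in> C" using M.add.rcos_self[OF a(1) K] by (simp add: a_r_coset_def)
    then have "C \<noteq> {}" by auto
    then show ?thesis by (simp add: some_in_eq)
  qed
  have "C = D" if "C \<in> a_rcosets\<^bsub>M\<^esub> K" "D \<in> a_rcosets\<^bsub>M\<^esub> K" "(SOME x. x \<in> C) = (SOME x. x \<in> D)" for C D
  proof -
    have "C \<inter> D \<noteq> {}" using ne[OF that(1)] ne[OF that(2)] that(3) by auto
    then show ?thesis
      using that(1,2) M.add.rcos_disjoint[OF K] unfolding A_RCOSETS_def pairwise_def disjnt_def by blast
  qed
  then show ?thesis by (auto simp: inj_on_def quot_def)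
qed

lemma quot_coset:
  assumes "right_module R M" "submodule K R M"
  shows "a \<in> carrier R \<Longrightarrow> x \<in> carrier M \<Longrightarrow> a \<odot>\<^bsub>quot M K\<^esub> (K +>\<^bsub>M\<^esub> x) = K +>\<^bsub>M\<^esub> (a \<odot>\<^bsub>M\<^esub> x)"
   and "x \<in> carrier M \<Longrightarrow> y \<in> carrier M \<Longrightarrow> (K +>\<^bsub>M\<^esub> x) \<oplus>\<^bsub>quot M K\<^esub> (K +>\<^bsub>M\<^esub> y) = K +>\<^bsub>M\<^esub> (x \<oplus>\<^bsub>M\<^esub> y)"
proof -
  interpret right_module R M by fact
  interpret K: submodule K R M by fact
  have N: "K \<lhd> add_monoid M"
    using M.a_comm_group K.subgroup_axioms by (simp add: comm_group.normal_iff_subgroup)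
  { assume x: "x \<in> carrier M" and y: "y \<in> carrier M" 
    then show "(K +>\<^bsub>M\<^esub> x) \<oplus>\<^bsub>quot M K\<^esub> (K +>\<^bsub>M\<^esub> y) = K +>\<^bsub>M\<^esub> (x \<oplus>\<^bsub>M\<^esub> y)"
    using normal.rcos_sum[OF N] by (simp add: quot_def set_add_def a_r_coset_def) }
  assume a: "a \<in> carrier R" and x: "x \<in> carrier M"
  have Kc: "k \<in> carrier M" if "k \<in> K" for k using K.subset that by auto
  have "K +>\<^bsub>M\<^esub> (a \<odot>\<^bsub>M\<^esub> (k \<oplus>\<^bsub>M\<^esub> x)) = K +>\<^bsub>M\<^esub> (a \<odot>\<^bsub>M\<^esub> x)" if k: "k \<in> K" for k
  proof -
    have "a \<odot>\<^bsub>M\<^esub> (k \<oplus>\<^bsub>M\<^esub> x) = a \<odot>\<^bsub>M\<^esub> k \<oplus>\<^bsub>M\<^esub> a \<odot>\<^bsub>M\<^esub> x" using smult_add a x Kc k by auto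
    moreover have "K +>\<^bsub>M\<^esub> (a \<odot>\<^bsub>M\<^esub> k) = K" using K.smult_closed[OF a k]
      using M.add.coset_join2 K.subgroup_axioms Kc by (simp add: a_r_coset_def)
    ultimately show ?thesis
      using M.add.coset_mult_assoc[of K "a \<odot>\<^bsub>M\<^esub> k" "a \<odot>\<^bsub>M\<^esub> x"] K.subset smult_closed a x Kc k
      by (simp add: a_r_coset_def)
  qed
  then show "a \<odot>\<^bsub>quot M K\<^esub> (K +>\<^bsub>M\<^esub> x) = K +>\<^bsub>M\<^esub> (a \<odot>\<^bsub>M\<^esub> x)"
    using K.one_closed by (auto simp: quot_def a_r_coset_def')
qed

lemma quot_right_module:
  assumes "right_module R M" "submodule K R M"
  shows "right_module R (quot M K)"
proof -
  interpret right_module R M by fact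
  interpret K: submodule K R M by fact
  note q = quot_coset[OF assms]
  have c: "carrier (quot M K) = (\<lambda>x. K +>\<^bsub>M\<^esub> x) ` carrier M" by (auto simp: quot_def A_RCOSETS_def')
  have z: "\<zero>\<^bsub>quot M K\<^esub> = K +>\<^bsub>M\<^esub> \<zero>\<^bsub>M\<^esub>" using K.subset by (simp add: quot_def)
  show ?thesis
  proof (intro right_module.intro R.ring_axioms right_module_axioms.intro abelian_groupI)
    fix X assume "X \<in> carrier (quot M K)"
    then obtain x where x: "x \<in> carrier M" "X = K +>\<^bsub>M\<^esub> x" by (auto simp: c)
    show "\<exists>Y\<in>carrier (quot M K). Y \<oplus>\<^bsub>quot M K\<^esub> X = \<zero>\<^bsub>quot M K\<^esub>"
      using x by (intro bexI[of _ "K +>\<^bsub>M\<^esub> (\<ominus>\<^bsub>M\<^esub> x)"]) (auto simp: c z q M.l_neg)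
  qed (auto simp: c z q M.a_ac smult_closed smult_add_scalar smult_add smult_assoc smult_one)
qed

end

theory Submission
  imports Defs
begin

text \<open>
  By subadditivity the limit defining \<open>ent(\<phi>, N)\<close> is the infimum of \<open>L(T\<^sub>n(\<phi>, N)) / n\<close>. Since
  \<open>T\<^sub>n\<^sub>+\<^sub>k(\<phi>, N) = T\<^sub>k(\<phi>, N) + T\<^sub>n(\<phi>, \<phi>\<^sup>k(N))\<close>, replacing \<open>N\<close> by \<open>\<phi>\<^sup>k(N)\<close> does not decrease the
  entropy, so \<open>n \<cdot> ent(\<phi>, N) \<le> L(\<phi>\<^sup>k(T\<^sub>n)) = L(T\<^sub>n) - L(T\<^sub>n \<inter> Ker(\<phi>\<^sup>k))\<close> for all \<open>n\<close> and \<open>k\<close>. Letting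
  \<open>k\<close> tend to infinity, upper continuity gives \<open>n \<cdot> ent(\<phi>, N) \<le> L(T\<^sub>n) - L(T\<^sub>n \<inter> K)\<close>, which is the length
  of the trajectory of the image of \<open>N\<close> in \<open>M/K\<close>. Hence \<open>N\<close> and its image have the same entropy. Finally,
  an \<open>L\<close>-finite submodule of \<open>M/K\<close> is, up to arbitrarily small length, the image of a finitely generated
  submodule of \<open>M\<close>, which is \<open>L\<close>-finite because \<open>M\<close> is locally \<open>L\<close>-finite, and a perturbation of length
  \<open>\<epsilon>\<close> changes the entropy by at most \<open>\<epsilon>\<close>.
\<close>

subsection \<open>Submodules and homomorphisms\<close>

text \<open>The predicate \<open>submodule\<close> is built on subgroups of the additive group and
  so also asks for closure under negation. Over a unital ring this follows from scalar closure,
  because the scalar \<open>-1\<close> acts as negation.\<close>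

lemma submodule_iff:
  assumes "right_module R M"
  shows "submodule H R M \<longleftrightarrow> H \<subseteq> carrier M \<and> \<zero>\<^bsub>M\<^esub> \<in> H \<and> (\<forall>x\<in>H. \<forall>y\<in>H. x \<oplus>\<^bsub>M\<^esub> y \<in> H) \<and>
    (\<forall>a\<in>carrier R. \<forall>x\<in>H. a \<odot>\<^bsub>M\<^esub> x \<in> H)" (is "_ \<longleftrightarrow> ?P")
proof
  assume "submodule H R M"
  then interpret submodule H R M .
  show ?P using subset one_closed m_closed smult_closed by auto
next
  interpret right_module R M by fact
  assume P: ?P
  have zero: "\<zero>\<^bsub>R\<^esub> \<odot>\<^bsub>M\<^esub> x = \<zero>\<^bsub>M\<^esub>" if "x \<in> carrier M" for x
    using smult_add_scalar[of "\<zero>\<^bsub>R\<^esub>" "\<zero>\<^bsub>R\<^esub>" x] smult_closed[of "\<zero>\<^bsub>R\<^esub>" x] that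
      M.add.l_cancel_one'[of "\<zero>\<^bsub>R\<^esub> \<odot>\<^bsub>M\<^esub> x" "\<zero>\<^bsub>R\<^esub> \<odot>\<^bsub>M\<^esub> x"] by simp
  have neg: "(\<ominus>\<^bsub>R\<^esub> \<one>\<^bsub>R\<^esub>) \<odot>\<^bsub>M\<^esub> x = \<ominus>\<^bsub>M\<^esub> x" if "x \<in> carrier M" for x
  proof -
    have "(\<ominus>\<^bsub>R\<^esub> \<one>\<^bsub>R\<^esub>) \<odot>\<^bsub>M\<^esub> x \<oplus>\<^bsub>M\<^esub> x = \<zero>\<^bsub>M\<^esub>"
      using smult_add_scalar[of "\<ominus>\<^bsub>R\<^esub> \<one>\<^bsub>R\<^esub>" "\<one>\<^bsub>R\<^esub>" x] that zero by (simp add: smult_one R.l_neg)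
    then show ?thesis using that smult_closed by (metis M.minus_equality R.add.inv_closed R.one_closed)
  qed
  show "submodule H R M"
  proof (intro submodule.intro subgroup.intro submodule_axioms.intro)
    fix x assume x: "x \<in> H"
    then have "x \<in> carrier M" using P by auto
    then have "\<ominus>\<^bsub>M\<^esub> x \<in> H" using neg[of x] P x by (metis R.add.inv_closed R.one_closed)
    then show "inv\<^bsub>add_monoid M\<^esub> x \<in> H" by (simp add: a_inv_def)
  qed (use P in auto)
qed

lemmas submoduleD = submodule_iff[THEN iffD1]

lemma (in right_module) sub_right_module:
  assumes "submodule H R M"
  shows "right_module R (sub_of M H)"
proof -
  interpret H: submodule H R M by fact
  have c: "x \<in> H \<Longrightarrow> x \<in> carrier M" for x using H.subset by auto
  show ?thesis
  proof (intro right_module.intro R.ring_axioms right_module_axioms.intro abelian_groupI)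
    fix x assume x: "x \<in> carrier (sub_of M H)"
    then show "\<exists>y\<in>carrier (sub_of M H). y \<oplus>\<^bsub>sub_of M H\<^esub> x = \<zero>\<^bsub>sub_of M H\<^esub>"
      using c H.m_inv_closed[of x] M.l_neg[of x] by (intro bexI[of _ "\<ominus>\<^bsub>M\<^esub> x"]) (auto simp: a_inv_def)
  qed (use H.one_closed H.m_closed H.smult_closed c in
      \<open>auto simp: M.a_ac smult_add_scalar smult_add smult_assoc smult_one\<close>)
qed

lemma submodule_sub_of_iff:
  assumes "right_module R M" "submodule A R M"
  shows "submodule B R (sub_of M A) \<longleftrightarrow> submodule B R M \<and> B \<subseteq> A"
  unfolding submodule_iff[OF assms(1)] submodule_iff[OF right_module.sub_right_module[OF assms]]
  using submoduleD[OF assms] by auto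

lemma (in right_module) submodule_carrier: "submodule (carrier M) R M"
  using smult_closed by (auto simp: submodule_iff[OF right_module_axioms])

lemma (in right_module) submodule_Int:
  "submodule A R M \<Longrightarrow> submodule B R M \<Longrightarrow> submodule (A \<inter> B) R M"
  by (auto simp: submodule_iff[OF right_module_axioms])

lemma (in right_module) submodule_rspan: "S \<subseteq> carrier M \<Longrightarrow> submodule (rspan R M S) R M"
  unfolding rspan_def using submodule_carrier by (auto simp: submodule_iff[OF right_module_axioms])

lemma rspan_superset: "S \<subseteq> rspan R M S"
  by (auto simp: rspan_def)

lemma rspan_least: "submodule H R M \<Longrightarrow> S \<subseteq> H \<Longrightarrow> rspan R M S \<subseteq> H"
  by (auto simp: rspan_def)

lemma set_addI: "x \<in> A \<Longrightarrow> y \<in> B \<Longrightarrow> x \<oplus>\<^bsub>M\<^esub> y \<in> A <+>\<^bsub>M\<^esub> B"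
  by (auto simp: set_add_def')

lemma set_add_iff: "z \<in> A <+>\<^bsub>M\<^esub> B \<longleftrightarrow> (\<exists>x\<in>A. \<exists>y\<in>B. z = x \<oplus>\<^bsub>M\<^esub> y)"
  by (auto simp: set_add_def')

lemma (in right_module) submodule_set_add:
  assumes A: "submodule A R M" and B: "submodule B R M"
  shows "submodule (A <+>\<^bsub>M\<^esub> B) R M"
proof -
  note a = submoduleD[OF right_module_axioms A] and b = submoduleD[OF right_module_axioms B]
  have c: "x \<in> A \<Longrightarrow> x \<in> carrier M" "x \<in> B \<Longrightarrow> x \<in> carrier M" for x using a b by auto
  show ?thesis unfolding submodule_iff[OF right_module_axioms]
  proof (intro conjI ballI)
    show "A <+>\<^bsub>M\<^esub> B \<subseteq> carrier M" using c by (auto simp: set_add_iff)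
    show "\<zero>\<^bsub>M\<^esub> \<in> A <+>\<^bsub>M\<^esub> B" using a b by (auto simp: set_add_iff intro!: bexI[of _ "\<zero>\<^bsub>M\<^esub>"])
  next
    fix u v assume "u \<in> A <+>\<^bsub>M\<^esub> B" "v \<in> A <+>\<^bsub>M\<^esub> B"
    then obtain x y x' y' where *: "x \<in> A" "y \<in> B" "x' \<in> A" "y' \<in> B" "u = x \<oplus>\<^bsub>M\<^esub> y" "v = x' \<oplus>\<^bsub>M\<^esub> y'"
      by (auto simp: set_add_iff)
    then have "u \<oplus>\<^bsub>M\<^esub> v = (x \<oplus>\<^bsub>M\<^esub> x') \<oplus>\<^bsub>M\<^esub> (y \<oplus>\<^bsub>M\<^esub> y')" using c by (simp add: M.a_ac)
    then show "u \<oplus>\<^bsub>M\<^esub> v \<in> A <+>\<^bsub>M\<^esub> B" using * a b by (simp add: set_addI)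
  next
    fix r u assume r: "r \<in> carrier R" and "u \<in> A <+>\<^bsub>M\<^esub> B"
    then obtain x y where *: "x \<in> A" "y \<in> B" "u = x \<oplus>\<^bsub>M\<^esub> y" by (auto simp: set_add_iff)
    then have "r \<odot>\<^bsub>M\<^esub> u = r \<odot>\<^bsub>M\<^esub> x \<oplus>\<^bsub>M\<^esub> r \<odot>\<^bsub>M\<^esub> y" using r c smult_add by simp
    then show "r \<odot>\<^bsub>M\<^esub> u \<in> A <+>\<^bsub>M\<^esub> B" using * a b r by (simp add: set_addI)
  qed
qed

lemma (in right_module)
  assumes A: "submodule A R M" and B: "submodule B R M"
  shows set_add_upper1: "A \<subseteq> A <+>\<^bsub>M\<^esub> B"
    and set_add_upper2: "B \<subseteq> A <+>\<^bsub>M\<^esub> B"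
proof -
  note a = submoduleD[OF right_module_axioms A] and b = submoduleD[OF right_module_axioms B]
  show "A \<subseteq> A <+>\<^bsub>M\<^esub> B"
  proof
    fix x assume "x \<in> A"
    then show "x \<in> A <+>\<^bsub>M\<^esub> B" using a b set_addI[of x A "\<zero>\<^bsub>M\<^esub>" B M] by auto
  qed
  show "B \<subseteq> A <+>\<^bsub>M\<^esub> B"
  proof
    fix x assume "x \<in> B"
    then show "x \<in> A <+>\<^bsub>M\<^esub> B" using a b set_addI[of "\<zero>\<^bsub>M\<^esub>" A x B M] by auto
  qed
qed

lemma set_add_least:
  assumes "right_module R M" "submodule C R M" "A \<subseteq> C" "B \<subseteq> C"
  shows "A <+>\<^bsub>M\<^esub> B \<subseteq> C"
  using submoduleD[OF assms(1,2)] assms(3,4) unfolding set_add_def' by blast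

lemma set_add_mono: "A \<subseteq> A' \<Longrightarrow> B \<subseteq> B' \<Longrightarrow> A <+>\<^bsub>M\<^esub> B \<subseteq> A' <+>\<^bsub>M\<^esub> B'"
  unfolding set_add_def' by blast

section \<open>Homomorphisms of right modules: images, preimages and kernels\<close>

locale rmod_morphism = M: right_module R M + N: right_module R N
  for R :: "'r ring" and M :: "('r, 'm) module" and N :: "('r, 'n) module" +
  fixes h :: "'m \<Rightarrow> 'n"
  assumes hom: "h \<in> rmod_hom R M N"
begin

lemma closed: "x \<in> carrier M \<Longrightarrow> h x \<in> carrier N"
  and add: "x \<in> carrier M \<Longrightarrow> y \<in> carrier M \<Longrightarrow> h (x \<oplus>\<^bsub>M\<^esub> y) = h x \<oplus>\<^bsub>N\<^esub> h y"
  and smult: "a \<in> carrier R \<Longrightarrow> x \<in> carrier M \<Longrightarrow> h (a \<odot>\<^bsub>M\<^esub> x) = a \<odot>\<^bsub>N\<^esub> h x"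
  using hom by (auto simp: rmod_hom_def)

lemma zero: "h \<zero>\<^bsub>M\<^esub> = \<zero>\<^bsub>N\<^esub>"
  using add[of "\<zero>\<^bsub>M\<^esub>" "\<zero>\<^bsub>M\<^esub>"] closed[of "\<zero>\<^bsub>M\<^esub>"] N.M.add.l_cancel_one' by simp

lemma minus:
  assumes "x \<in> carrier M" "y \<in> carrier M"
  shows "h (x \<ominus>\<^bsub>M\<^esub> y) = h x \<ominus>\<^bsub>N\<^esub> h y"
proof -
  have "h (\<ominus>\<^bsub>M\<^esub> y) \<oplus>\<^bsub>N\<^esub> h y = \<zero>\<^bsub>N\<^esub>"
    using add[of "\<ominus>\<^bsub>M\<^esub> y" y] zero assms by (simp add: M.M.l_neg)
  then have "h (\<ominus>\<^bsub>M\<^esub> y) = \<ominus>\<^bsub>N\<^esub> h y"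
    using closed assms by (metis M.M.add.inv_closed N.M.minus_equality)
  then show ?thesis using assms add by (simp add: a_minus_def)
qed

lemma submodule_image:
  assumes "submodule A R M"
  shows "submodule (h ` A) R N"
proof -
  note a = submoduleD[OF M.right_module_axioms assms]
  show ?thesis unfolding submodule_iff[OF N.right_module_axioms]
  proof (intro conjI ballI)
    show "h ` A \<subseteq> carrier N" using a closed by auto
    show "\<zero>\<^bsub>N\<^esub> \<in> h ` A" using a zero by (metis imageI)
    fix x y assume "x \<in> h ` A" "y \<in> h ` A"
    then obtain u v where "u \<in> A" "v \<in> A" "x = h u" "y = h v" by auto
    then show "x \<oplus>\<^bsub>N\<^esub> y \<in> h ` A"
      using a add[of u v] by (metis imageI subsetD)
  next
    fix r x assume "r \<in> carrier R" "x \<in> h ` A"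
    then obtain u where "u \<in> A" "x = h u" by auto
    then show "r \<odot>\<^bsub>N\<^esub> x \<in> h ` A"
      using a smult[of r u] \<open>r \<in> carrier R\<close> by (metis imageI subsetD)
  qed
qed

lemma submodule_vimage:
  assumes "submodule B R N"
  shows "submodule {x \<in> carrier M. h x \<in> B} R M"
  using submoduleD[OF N.right_module_axioms assms] closed add smult zero M.smult_closed
  unfolding submodule_iff[OF M.right_module_axioms] by auto

lemma submodule_kernel: "submodule (a_kernel M N h) R M"
proof -
  have "submodule {\<zero>\<^bsub>N\<^esub>} R N"
  proof -
    have "a \<odot>\<^bsub>N\<^esub> \<zero>\<^bsub>N\<^esub> = \<zero>\<^bsub>N\<^esub>" if "a \<in> carrier R" for a
      using N.smult_add[of a "\<zero>\<^bsub>N\<^esub>" "\<zero>\<^bsub>N\<^esub>"] N.smult_closed[of a "\<zero>\<^bsub>N\<^esub>"] that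
        N.M.add.l_cancel_one'[of "a \<odot>\<^bsub>N\<^esub> \<zero>\<^bsub>N\<^esub>" "a \<odot>\<^bsub>N\<^esub> \<zero>\<^bsub>N\<^esub>"] by simp
    then show ?thesis by (simp add: submodule_iff[OF N.right_module_axioms])
  qed
  from submodule_vimage[OF this] show ?thesis by (simp add: a_kernel_def')
qed

lemma image_set_add:
  assumes "A \<subseteq> carrier M" "B \<subseteq> carrier M"
  shows "h ` (A <+>\<^bsub>M\<^esub> B) = h ` A <+>\<^bsub>N\<^esub> h ` B"
proof -
  have "h (x \<oplus>\<^bsub>M\<^esub> y) = h x \<oplus>\<^bsub>N\<^esub> h y" if "x \<in> A" "y \<in> B" for x y
    using that assms add by blast
  then show ?thesis unfolding set_add_def' by (auto simp: image_UN)
qed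

end

text \<open>The zero submodule is the kernel of the identity map.\<close>

lemma (in right_module) submodule_zero: "submodule {\<zero>\<^bsub>M\<^esub>} R M"
proof -
  interpret rmod_morphism R M M "\<lambda>x. x"
    by unfold_locales (auto simp: rmod_hom_def)
  show ?thesis using submodule_kernel by (simp add: a_kernel_def' conj_commute cong: conj_cong)
qed

lemma rmod_morphismI:
  "right_module R M \<Longrightarrow> right_module R N \<Longrightarrow> h \<in> rmod_hom R M N \<Longrightarrow> rmod_morphism R M N h"
  by (simp add: rmod_morphism_def rmod_morphism_axioms_def)

lemma (in right_module) rmod_hom_coset:
  assumes "submodule B R M"
  shows "(\<lambda>x. B +>\<^bsub>M\<^esub> x) \<in> rmod_hom R M (quot M B)"
  using quot_coset[OF right_module_axioms assms]
  by (auto simp: rmod_hom_def quot_def A_RCOSETS_def')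

lemma (in right_module) coset_eq_iff:
  assumes "submodule B R M" "x \<in> carrier M" "y \<in> carrier M"
  shows "B +>\<^bsub>M\<^esub> x = B +>\<^bsub>M\<^esub> y \<longleftrightarrow> x \<ominus>\<^bsub>M\<^esub> y \<in> B"
proof -
  have B: "subgroup B (add_monoid M)" using assms(1) by (rule submodule.axioms)
  have "B +>\<^bsub>M\<^esub> x = B +>\<^bsub>M\<^esub> y \<longleftrightarrow> x \<in> B +>\<^bsub>M\<^esub> y"
    using M.add.repr_independenceD[OF B, of x y] M.add.repr_independence[OF _ _ B, of x y] assms
    by (auto simp: a_r_coset_def)
  also have "\<dots> \<longleftrightarrow> x \<ominus>\<^bsub>M\<^esub> y \<in> B"
    using subgroup.rcos_module[OF B M.add.is_group, of y x] assms
    by (simp add: a_r_coset_def a_minus_def a_inv_def)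
  finally show ?thesis .
qed

lemma (in right_module) kernel_coset:
  assumes "submodule B R M"
  shows "a_kernel M (quot M B) (\<lambda>x. B +>\<^bsub>M\<^esub> x) = B"
proof -
  have b: "B \<subseteq> carrier M" using submoduleD[OF right_module_axioms assms] by auto
  then have "B +>\<^bsub>M\<^esub> \<zero>\<^bsub>M\<^esub> = B" by simp
  moreover have "x \<ominus>\<^bsub>M\<^esub> \<zero>\<^bsub>M\<^esub> = x" if "x \<in> carrier M" for x
    using that M.minus_equality[of "\<zero>\<^bsub>M\<^esub>" "\<zero>\<^bsub>M\<^esub>"] by (simp add: a_minus_def)
  ultimately have "B +>\<^bsub>M\<^esub> x = B \<longleftrightarrow> x \<in> B" if "x \<in> carrier M" for x
    using coset_eq_iff[OF assms that, of "\<zero>\<^bsub>M\<^esub>"] that by simp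
  then show ?thesis
    using b by (auto simp: a_kernel_def' quot_def)
qed

subsection \<open>Lengths of submodules\<close>

text \<open>The elements of \<open>M\<close> may have a type other than \<open>'u\<close>, on which
  \<open>L\<close> is given. The assumption \<open>embeds\<close> provides every submodule with an
  isomorphic copy over \<open>'u\<close>, so that \<open>length_at\<close> is meaningful there. The
  locale thereby covers both a module over \<open>'u\<close> and its quotients, whose elements are
  cosets.\<close>

locale measured_module = right_module R M
  for R :: "'r ring" and M :: "('r, 'm) module" (structure) +
  fixes L :: "('r, 'u) module \<Rightarrow> ennreal"
  assumes length_function: "length_function R L"
    and embeds: "\<exists>f :: 'm \<Rightarrow> 'u. inj_on f (carrier M)"
begin

definition len :: "'m set \<Rightarrow> ennreal" where
  "len A = length_at R L (sub_of M A)"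

lemma Fin_sub_iff: "A \<in> Fin_sub R (length_at R L) M \<longleftrightarrow> submodule A R M \<and> len A < \<infinity>"
  by (simp add: Fin_sub_def len_def)

lemma ex_sub_copy:
  assumes "submodule A R M"
  shows "\<exists>P :: ('r, 'u) module. right_module R P \<and> rmod_iso R P (sub_of M A)"
proof -
  have "A \<subseteq> carrier M" using submoduleD[OF right_module_axioms assms] by simp
  with embeds obtain f :: "'m \<Rightarrow> 'u" where "inj_on f A" by (meson inj_on_subset)
  then show ?thesis using ex_copy[OF sub_right_module[OF assms]] by simp
qed

lemma len_eq:
  "right_module R P \<Longrightarrow> rmod_iso R P (sub_of M A) \<Longrightarrow> len A = L P"
  unfolding len_def by (rule length_at_eq[OF length_function])

end

section \<open>Additivity of length along a homomorphism\<close>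

locale measured_morphism = rmod_morphism R M N h + M: measured_module R M L + N: measured_module R N L
  for R :: "'r ring" and M :: "('r, 'm) module" and N :: "('r, 'n) module"
    and h :: "'m \<Rightarrow> 'n" and L :: "('r, 'u) module \<Rightarrow> ennreal"
begin

lemma len_image_kernel:
  assumes A: "submodule A R M"
  shows "M.len A = N.len (h ` A) + M.len (A \<inter> a_kernel M N h)"
proof -
  have Ac: "A \<subseteq> carrier M" using submoduleD[OF M.right_module_axioms A] by simp
  have hA: "submodule (h ` A) R N" using A by (rule submodule_image)
  obtain P :: "('r, 'u) module" where P: "right_module R P" "rmod_iso R P (sub_of M A)"
    using M.ex_sub_copy[OF A] by blast
  obtain Q :: "('r, 'u) module" where Q: "right_module R Q" "rmod_iso R Q (sub_of N (h ` A))"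
    using N.ex_sub_copy[OF hA] by blast
  obtain i where i: "i \<in> rmod_hom R P (sub_of M A)" "bij_betw i (carrier P) A"
    using P(2) by (auto simp: rmod_iso_def)
  obtain j where j: "j \<in> rmod_hom R (sub_of N (h ` A)) Q" "bij_betw j (h ` A) (carrier Q)"
    using rmod_iso_sym[OF Q] by (auto simp: rmod_iso_def)
  interpret j: rmod_morphism R "sub_of N (h ` A)" Q j
    using rmod_morphismI N.sub_right_module[OF hA] Q(1) j(1) by metis
  define g where "g = j \<circ> h \<circ> i"
  have ic: "i x \<in> A" "i x \<in> carrier M" if "x \<in> carrier P" for x
    using bij_betwE[OF i(2)] that Ac by auto
  have g: "g \<in> rmod_hom R P Q"
    using i(1) j.closed j.add j.smult ic add smult by (auto simp: rmod_hom_def g_def)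
  interpret g: rmod_morphism R P Q g
    using rmod_morphismI P(1) Q(1) g by metis
  have j0: "j y = \<zero>\<^bsub>Q\<^esub> \<longleftrightarrow> y = \<zero>\<^bsub>N\<^esub>" if "y \<in> h ` A" for y
    using j.zero inj_onD[OF bij_betw_imp_inj_on[OF j(2)], of y "\<zero>\<^bsub>N\<^esub>"] that
      submoduleD[OF N.right_module_axioms hA] by auto
  let ?S = "a_kernel P Q g"
  \<comment> \<open>As \<open>j\<close> is injective, \<open>g\<close> vanishes exactly where
    \<open>h \<circ> i\<close> does. Thus \<open>i\<close> identifies the kernel of \<open>g\<close>
    with the part of the kernel of \<open>h\<close> inside \<open>A\<close>.\<close>
  have S: "?S = {x \<in> carrier P. i x \<in> A \<inter> a_kernel M N h}"
    using ic j0 by (auto simp: a_kernel_def' g_def)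
  have Sr: "right_module R (sub_of P ?S)"
    using g.M.sub_right_module g.submodule_kernel by blast
  have "i ` ?S = A \<inter> a_kernel M N h"
    using bij_betw_imp_surj_on[OF i(2)] by (force simp: S)
  moreover have "?S \<subseteq> carrier P" by (auto simp: S)
  ultimately have "bij_betw i ?S (A \<inter> a_kernel M N h)"
    using bij_betw_subset[OF i(2)] by blast
  moreover have "i \<in> rmod_hom R (sub_of P ?S) (sub_of M (A \<inter> a_kernel M N h))"
    using i(1) by (auto simp: rmod_hom_def S)
  ultimately have "rmod_iso R (sub_of P ?S) (sub_of M (A \<inter> a_kernel M N h))"
    by (auto simp: rmod_iso_def)
  then have 1: "M.len (A \<inter> a_kernel M N h) = L (sub_of P ?S)"
    using M.len_eq Sr by blast
  have "g ` carrier P = j ` h ` i ` carrier P"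
    by (simp add: g_def image_comp comp_assoc)
  also have "\<dots> = carrier Q"
    using bij_betw_imp_surj_on[OF i(2)] bij_betw_imp_surj_on[OF j(2)] by simp
  finally have "g ` carrier P = carrier Q" .
  then have "short_exact R (sub_of P ?S) (\<lambda>x. x) P g Q"
    using g by (auto simp: short_exact_def rmod_hom_def a_kernel_def')
  then have "L P = L (sub_of P ?S) + L Q"
    using M.length_function P(1) Q(1) Sr unfolding length_function_def by blast
  then show ?thesis
    using 1 M.len_eq[OF P] N.len_eq[OF Q] by (simp add: add.commute)
qed

lemma len_image_le: "submodule A R M \<Longrightarrow> N.len (h ` A) \<le> M.len A"
  by (simp add: len_image_kernel)

end

lemma measured_morphismI:
  "measured_module R M L \<Longrightarrow> measured_module R N L \<Longrightarrow> h \<in> rmod_hom R M N \<Longrightarrow> measured_morphism R M N h L"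
  by (simp add: measured_morphism_def measured_module_def rmod_morphismI)

section \<open>Monotonicity, the modular identity and approximation by finitely generated
  submodules\<close>

context measured_module
begin

text \<open>Sending each coset to a chosen representative embeds the quotient into \<open>M\<close>,
  and \<open>M\<close> embeds into \<open>'u\<close>.\<close>

lemma measured_quot:
  assumes "submodule B R M"
  shows "measured_module R (quot M B) L"
proof -
  obtain f :: "'m \<Rightarrow> 'u" where f: "inj_on f (carrier M)" using embeds by blast
  let ?r = "\<lambda>C. SOME x. x \<in> C"
  have "?r C \<in> carrier M" if C: "C \<in> carrier (quot M B)" for C
  proof -
    obtain a where "a \<in> carrier M" "C = B +>\<^bsub>M\<^esub> a" using C by (auto simp: quot_def A_RCOSETS_def')
    moreover have "B \<subseteq> carrier M" "\<zero>\<^bsub>M\<^esub> \<in> B" using submoduleD[OF right_module_axioms assms] by auto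
    ultimately have "C \<noteq> {}" "C \<subseteq> carrier M" by (auto simp: a_r_coset_def')
    then show ?thesis using some_in_eq by blast
  qed
  then have "inj_on (f \<circ> ?r) (carrier (quot M B))"
    using f by (intro comp_inj_on inj_on_coset_rep[OF right_module_axioms assms]) (auto intro: inj_on_subset)
  then show ?thesis
    unfolding measured_module_def measured_module_axioms_def
    using quot_right_module[OF right_module_axioms assms] length_function by blast
qed

lemma measured_coset:
  assumes "submodule B R M"
  shows "measured_morphism R M (quot M B) (\<lambda>x. B +>\<^bsub>M\<^esub> x) L"
  using measured_morphismI[OF measured_module_axioms measured_quot[OF assms] rmod_hom_coset[OF assms]] .

text \<open>Additivity along the projection modulo \<open>A\<close> writes the length of
  \<open>B\<close> as that of \<open>B/A\<close> plus that of \<open>A\<close>.\<close>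

lemma len_mono:
  assumes A: "submodule A R M" and B: "submodule B R M" and "A \<subseteq> B"
  shows "len A \<le> len B"
proof -
  interpret measured_morphism R M "quot M A" "\<lambda>x. A +>\<^bsub>M\<^esub> x" L using A by (rule measured_coset)
  have "B \<inter> A = A" using assms by auto
  then show ?thesis using len_image_kernel[OF B] kernel_coset[OF A] by simp
qed

text \<open>Both sums equal \<open>len ((A + B) / B) + len B + len (A \<inter> B)\<close>.\<close>

lemma len_set_add_Int:
  assumes A: "submodule A R M" and B: "submodule B R M"
  shows "len (A <+>\<^bsub>M\<^esub> B) + len (A \<inter> B) = len A + len B"
proof -
  interpret measured_morphism R M "quot M B" "\<lambda>x. B +>\<^bsub>M\<^esub> x" L using B by (rule measured_coset)
  let ?q = "\<lambda>x. B +>\<^bsub>M\<^esub> x"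
  have a: "A \<subseteq> carrier M" and b: "B \<subseteq> carrier M" and b0: "\<zero>\<^bsub>M\<^esub> \<in> B"
    using submoduleD[OF right_module_axioms] A B by auto
  have "?q (x \<oplus>\<^bsub>M\<^esub> y) = ?q x" if "x \<in> A" "y \<in> B" for x y
  proof -
    have "x \<oplus>\<^bsub>M\<^esub> y \<ominus>\<^bsub>M\<^esub> x = y"
      using that a b M.add.m_comm[of x y] M.add.m_assoc[of y x "\<ominus>\<^bsub>M\<^esub> x"]
      by (simp add: a_minus_def subset_iff M.r_neg)
    then show ?thesis using that a b by (subst coset_eq_iff[OF B]) auto
  qed
  then have "?q ` (A <+>\<^bsub>M\<^esub> B) = ?q ` A" using b0 unfolding set_add_def' by (force simp: image_UN)
  moreover have "(A <+>\<^bsub>M\<^esub> B) \<inter> B = B" using set_add_upper2[OF A B] by auto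
  ultimately show ?thesis
    using len_image_kernel[OF A] len_image_kernel[OF submodule_set_add[OF A B]] kernel_coset[OF B]
    by (simp add: ac_simps)
qed

lemma len_set_add_le: "submodule A R M \<Longrightarrow> submodule B R M \<Longrightarrow> len (A <+>\<^bsub>M\<^esub> B) \<le> len A + len B"
  by (subst len_set_add_Int [symmetric]) simp_all

text \<open>The modular identity is applied to \<open>A\<close> and \<open>B + C\<close>: their sum
  is \<open>A + C\<close>, and their intersection contains \<open>B\<close>. The length of
  \<open>B\<close> is then cancelled, which is legitimate because it is finite.\<close>

lemma len_set_add_left_le:
  assumes A: "submodule A R M" and B: "submodule B R M" and C: "submodule C R M"
    and "B \<subseteq> A" and le: "len A \<le> len B + e" and fin: "len B < \<infinity>"
  shows "len (A <+>\<^bsub>M\<^esub> C) \<le> len (B <+>\<^bsub>M\<^esub> C) + e"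
proof -
  note BC = submodule_set_add[OF B C]
  have eq: "A <+>\<^bsub>M\<^esub> C = A <+>\<^bsub>M\<^esub> (B <+>\<^bsub>M\<^esub> C)"
  proof
    show "A <+>\<^bsub>M\<^esub> C \<subseteq> A <+>\<^bsub>M\<^esub> (B <+>\<^bsub>M\<^esub> C)"
      using set_add_upper2[OF B C] by (intro set_add_mono) auto
    show "A <+>\<^bsub>M\<^esub> (B <+>\<^bsub>M\<^esub> C) \<subseteq> A <+>\<^bsub>M\<^esub> C"
      using submodule_set_add[OF A C] set_add_upper1[OF A C] set_add_upper2[OF A C] \<open>B \<subseteq> A\<close>
      by (intro set_add_least[OF right_module_axioms]) auto
  qed
  have "len (A <+>\<^bsub>M\<^esub> C) + len B \<le> len (A <+>\<^bsub>M\<^esub> C) + len (A \<inter> (B <+>\<^bsub>M\<^esub> C))"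
    using set_add_upper1[OF B C] \<open>B \<subseteq> A\<close> by (intro add_left_mono len_mono B submodule_Int A BC) auto
  also have "\<dots> = len A + len (B <+>\<^bsub>M\<^esub> C)"
    unfolding eq by (rule len_set_add_Int[OF A BC])
  also have "\<dots> \<le> len B + e + len (B <+>\<^bsub>M\<^esub> C)" using le by (rule add_right_mono)
  finally have "len B + len (A <+>\<^bsub>M\<^esub> C) \<le> len B + (len (B <+>\<^bsub>M\<^esub> C) + e)" by (simp add: ac_simps)
  then show ?thesis using fin by (auto simp: ennreal_add_left_cancel_le)
qed

text \<open>Upper continuity of \<open>L\<close> is available on a copy \<open>P\<close> of
  \<open>A\<close>. The generators found there are carried to \<open>A\<close> by the isomorphism
  \<open>i\<close>.\<close>

lemma len_approx_rspan:
  assumes A: "submodule A R M" and c: "c < len A"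
  shows "\<exists>S. finite S \<and> S \<subseteq> A \<and> c < len (rspan R M S)"
proof -
  obtain P :: "('r, 'u) module" where P: "right_module R P" "rmod_iso R P (sub_of M A)"
    using ex_sub_copy[OF A] by blast
  obtain i where i: "i \<in> rmod_hom R P (sub_of M A)" "bij_betw i (carrier P) A"
    using P(2) by (auto simp: rmod_iso_def)
  interpret i: rmod_morphism R P "sub_of M A" i
    using rmod_morphismI sub_right_module[OF A] P(1) i(1) by metis
  have "L P = (SUP F\<in>fg_submodules R P. L (sub_of P F))"
    using length_function P(1) unfolding length_function_def by blast
  then obtain T where T: "finite T" "T \<subseteq> carrier P" and cT: "c < L (sub_of P (rspan R P T))"
    using c len_eq[OF P] by (auto simp: less_SUP_iff fg_submodules_def)
  let ?F = "rspan R P T" and ?W = "rspan R M (i ` T)"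
  have F: "submodule ?F R P" using T(2) by (rule i.M.submodule_rspan)
  have Fc: "?F \<subseteq> carrier P" using submoduleD[OF P(1) F] by simp
  have TA: "i ` T \<subseteq> A" using T(2) bij_betwE[OF i(2)] by auto
  have W: "submodule ?W R M"
    using TA submoduleD[OF right_module_axioms A] by (intro submodule_rspan) auto
  have "?W \<subseteq> A" using A TA by (rule rspan_least)
  then have "submodule ?W R (sub_of M A)"
    using W submodule_sub_of_iff[OF right_module_axioms A] by simp
  \<comment> \<open>The preimage of \<open>?W\<close> under \<open>i\<close> is a submodule of
    \<open>P\<close> containing \<open>T\<close>, hence contains its span. This inclusion, with
    monotonicity of length, is enough for the bound.\<close>
  then have "?F \<subseteq> {x \<in> carrier P. i x \<in> ?W}"
    using T(2) rspan_superset by (intro rspan_least i.submodule_vimage) force+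
  then have sub: "i ` ?F \<subseteq> ?W" by auto
  have iF: "submodule (i ` ?F) R M"
    using i.submodule_image[OF F] submodule_sub_of_iff[OF right_module_axioms A] by simp
  have "bij_betw i ?F (i ` ?F)" using bij_betw_subset[OF i(2) Fc] by simp
  moreover have "i \<in> rmod_hom R (sub_of P ?F) (sub_of M (i ` ?F))"
    using i(1) Fc by (auto simp: rmod_hom_def subset_iff)
  ultimately have "rmod_iso R (sub_of P ?F) (sub_of M (i ` ?F))" by (auto simp: rmod_iso_def)
  then have "len (i ` ?F) = L (sub_of P ?F)" using len_eq i.M.sub_right_module[OF F] by blast
  then have "c < len ?W" using cT len_mono[OF iF W sub] by simp
  then show ?thesis using T(1) TA by blast
qed

lemma len_approx_rspan_add:
  assumes A: "submodule A R M" and fin: "len A < \<infinity>" and e: "0 < e"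
  shows "\<exists>S. finite S \<and> S \<subseteq> A \<and> len A \<le> len (rspan R M S) + e"
proof (cases "len A \<le> e")
  \<comment> \<open>When the length of \<open>A\<close> is at most \<open>e\<close>, the error term
    alone covers it, so the empty generating set works.\<close>
  case True
  then show ?thesis by (intro exI[of _ "{}"]) (auto intro: order_trans)
next
  case False
  then have "len A - e < len A"
    using fin e by (intro ennreal_between) (auto simp: top_unique)
  from len_approx_rspan[OF A this] obtain S
    where S: "finite S" "S \<subseteq> A" "len A - e < len (rspan R M S)" by blast
  then have "len A - e + e \<le> len (rspan R M S) + e" by (intro add_right_mono) simp
  then show ?thesis using S(1,2) False by (intro exI[of _ S]) (simp add: diff_add_cancel_ennreal)
qed

lemma len_zero: "len {\<zero>\<^bsub>M\<^esub>} = 0"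
proof -
  obtain P :: "('r, 'u) module" where P: "right_module R P" "rmod_iso R P (sub_of M {\<zero>\<^bsub>M\<^esub>})"
    using ex_sub_copy[OF submodule_zero] by blast
  interpret P: right_module R P by (rule P(1))
  obtain i where i: "bij_betw i (carrier P) {\<zero>\<^bsub>M\<^esub>}" using P(2) by (auto simp: rmod_iso_def)
  have "x = \<zero>\<^bsub>P\<^esub>" if "x \<in> carrier P" for x
    using inj_onD[OF bij_betw_imp_inj_on[OF i], of x "\<zero>\<^bsub>P\<^esub>"] bij_betwE[OF i] that P.M.zero_closed
    by simp
  then have "carrier P = {\<zero>\<^bsub>P\<^esub>}" using P.M.zero_closed by blast
  then have "L P = 0" using P(1) length_function by (simp add: length_function_def)
  then show ?thesis using len_eq[OF P] by simp
qed

end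

subsection \<open>Entropy of submodules\<close>

lemma ennreal_divide_of_nat_tendsto_0: "(\<lambda>n. ennreal r / of_nat n) \<longlonglongrightarrow> 0"
proof (cases "0 \<le> r")
  case True
  have "(\<lambda>n. ennreal (r / real n)) \<longlonglongrightarrow> ennreal 0"
    by (intro tendsto_ennrealI lim_const_over_n)
  \<comment> \<open>The equality is only eventual: at \<open>n = 0\<close>, real division gives 0,
    while dividing a positive \<open>ennreal\<close> by 0 gives infinity.\<close>
  moreover have "\<forall>\<^sub>F n in sequentially. ennreal (r / real n) = ennreal r / of_nat n"
    using eventually_gt_at_top[of 0]
    by eventually_elim (simp add: divide_ennreal[symmetric] True ennreal_of_nat_eq_real_of_nat)
  ultimately show ?thesis by (simp add: Lim_transform_eventually)
qed (simp add: ennreal_neg)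

text \<open>Fekete's argument: for fixed \<open>m\<close>, division with remainder bounds
  \<open>a n\<close> by \<open>n div m\<close> copies of \<open>a m\<close> plus an error
  independent of \<open>n\<close>, which disappears after division by \<open>n\<close>. The infimum
  starts at 1 to avoid division by 0.\<close>

lemma fekete_ennreal:
  fixes a :: "nat \<Rightarrow> ennreal"
  assumes sub: "\<And>m n. a (m + n) \<le> a m + a n" and fin: "\<And>n. a n < \<infinity>"
  shows "(\<lambda>n. a n / of_nat n) \<longlonglongrightarrow> (INF n\<in>{1..}. a n / of_nat n)" (is "_ \<longlonglongrightarrow> ?l")
proof (rule order_tendstoI)
  fix b assume b: "b < ?l"
  show "\<forall>\<^sub>F n in sequentially. b < a n / of_nat n"
    using eventually_ge_at_top[of "1 :: nat"]
  proof eventually_elim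
    case (elim n)
    then have "?l \<le> a n / of_nat n" by (intro INF_lower) simp
    then show ?case using b by (rule less_le_trans[rotated])
  qed
next
  fix c assume "?l < c"
  then obtain m where m: "1 \<le> m" and am: "a m / of_nat m < c"
    by (auto simp: INF_less_iff)
  \<comment> \<open>All terms are nonnegative, so \<open>C\<close> dominates
    \<open>a (n mod m)\<close> for every \<open>n\<close> at once.\<close>
  define C where "C = (\<Sum>r<m. a r)"
  have C: "C < \<infinity>" using fin by (simp add: C_def)
  \<comment> \<open>The summand \<open>a 0\<close> accounts for \<open>q = 0\<close>; subadditivity
    does not force it to vanish.\<close>
  have mult: "a (q * m) \<le> of_nat q * a m + a 0" for q
  proof (induction q)
    case (Suc q)
    have "a (Suc q * m) \<le> a m + a (q * m)" using sub[of m "q * m"] by simp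
    also have "\<dots> \<le> a m + (of_nat q * a m + a 0)" using Suc by (rule add_left_mono)
    finally show ?case by (simp add: ring_distribs ac_simps)
  qed simp
  have bound: "a n / of_nat n \<le> a m / of_nat m + (a 0 + C) / of_nat n" if n: "1 \<le> n" for n
  proof -
    have "a n \<le> a (n div m * m) + a (n mod m)" using sub[of "n div m * m" "n mod m"] by simp
    also have "\<dots> \<le> (of_nat (n div m) * a m + a 0) + C"
      using m by (intro add_mono mult) (auto simp: C_def intro!: member_le_sum)
    also have "\<dots> = of_nat (n div m) * a m + (a 0 + C)" by (simp add: ac_simps)
    finally have "a n / of_nat n \<le> of_nat (n div m) * a m / of_nat n + (a 0 + C) / of_nat n"
      by (metis divide_right_mono_ennreal add_divide_distrib_ennreal)
    also have "of_nat (n div m) * a m / of_nat n \<le> a m / of_nat m"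
    proof (rule divide_le_posI_ennreal)
      show "0 < (of_nat n :: ennreal)" using n by simp
      have "a m = of_nat m * (a m / of_nat m)"
        using m mult_divide_eq_ennreal[of "of_nat m" "a m"]
        by (simp add: ennreal_times_divide mult.commute)
      then have "of_nat (n div m) * a m = of_nat (n div m * m) * (a m / of_nat m)"
        by (metis mult.assoc of_nat_mult)
      also have "\<dots> \<le> of_nat n * (a m / of_nat m)" by (intro mult_right_mono of_nat_mono) auto
      finally show "of_nat (n div m) * a m \<le> of_nat n * (a m / of_nat m)" .
    qed
    finally show ?thesis by (simp add: add_right_mono)
  qed
  obtain r where r: "0 \<le> r" "a 0 + C = ennreal r"
    using C fin[of 0] by (cases "a 0 + C") (auto simp: less_top[symmetric])
  have "(\<lambda>n. (a 0 + C) / of_nat n) \<longlonglongrightarrow> 0"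
    using r by (simp add: ennreal_divide_of_nat_tendsto_0)
  then have "(\<lambda>n. a m / of_nat m + (a 0 + C) / of_nat n) \<longlonglongrightarrow> a m / of_nat m + 0"
    by (intro tendsto_add tendsto_const)
  then have "\<forall>\<^sub>F n in sequentially. a m / of_nat m + (a 0 + C) / of_nat n < c"
    using am by (intro order_tendstoD(2)) auto
  then show "\<forall>\<^sub>F n in sequentially. a n / of_nat n < c"
    using eventually_ge_at_top[of "1 :: nat"]
    by eventually_elim (rule le_less_trans[OF bound])
qed


section \<open>Sums of subsets and trajectories\<close>

lemma (in abelian_group) a_set_add_comm:
  assumes "A \<subseteq> carrier G" "B \<subseteq> carrier G"
  shows "A <+>\<^bsub>G\<^esub> B = B <+>\<^bsub>G\<^esub> A"
proof -
  have "A <+>\<^bsub>G\<^esub> B \<subseteq> B <+>\<^bsub>G\<^esub> A" if "A \<subseteq> carrier G" "B \<subseteq> carrier G" for A B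
  proof
    fix z assume "z \<in> A <+>\<^bsub>G\<^esub> B"
    then obtain x y where *: "x \<in> A" "y \<in> B" "z = x \<oplus> y" by (auto simp: set_add_iff)
    then have "z = y \<oplus> x" using that by (simp add: a_comm subset_iff)
    then show "z \<in> B <+>\<^bsub>G\<^esub> A" using * by (simp add: set_addI)
  qed
  then show ?thesis using assms by blast
qed

lemma (in abelian_group) a_set_add_assoc:
  assumes "A \<subseteq> carrier G" "B \<subseteq> carrier G" "C \<subseteq> carrier G"
  shows "A <+>\<^bsub>G\<^esub> B <+>\<^bsub>G\<^esub> C = A <+>\<^bsub>G\<^esub> (B <+>\<^bsub>G\<^esub> C)"
  using add.set_mult_assoc assms by (simp add: set_add_def)

text \<open>A map intertwining \<open>\<phi>\<close> and \<open>\<psi>\<close> intertwines their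
  powers and preserves sums. This serves both for \<open>h\<close> a power of \<open>\<phi>\<close>
  and for \<open>h\<close> the projection onto the quotient by the hyperkernel.\<close>

lemma (in rmod_morphism) trajectory_image:
  assumes A: "submodule A R M" and \<phi>: "\<phi> \<in> rmod_End R M"
    and comm: "\<And>x. x \<in> carrier M \<Longrightarrow> h (\<phi> x) = \<psi> (h x)"
  shows "trajectory N \<psi> (h ` A) n = h ` trajectory M \<phi> A n"
proof -
  have Ac: "A \<subseteq> carrier M" using submoduleD[OF M.right_module_axioms A] by simp
  have pc: "(\<phi> ^^ n) x \<in> carrier M" if "x \<in> carrier M" for x n
    using that \<phi> by (induction n) (auto simp: rmod_hom_def)
  have "h ((\<phi> ^^ n) x) = (\<psi> ^^ n) (h x)" if "x \<in> carrier M" for x n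
    using that comm pc by (induction n) auto
  then have img: "(\<psi> ^^ n) ` h ` A = h ` (\<phi> ^^ n) ` A" for n
    unfolding image_image using Ac by (intro image_cong) auto
  \<comment> \<open>The inclusion in the carrier is carried through the induction because
    \<open>image_set_add\<close> requires it.\<close>
  have "trajectory M \<phi> A n \<subseteq> carrier M \<and> trajectory N \<psi> (h ` A) n = h ` trajectory M \<phi> A n"
  proof (induction n)
    case (Suc n)
    have "(\<phi> ^^ n) ` A \<subseteq> carrier M" using Ac pc by auto
    with Suc show ?case
      using set_add_least[OF M.right_module_axioms M.submodule_carrier] by (simp add: image_set_add img)
  qed (simp add: zero)
  then show ?thesis by blast
qed

locale measured_endo = measured_morphism R M M \<phi> L
  for R :: "'r ring" and M :: "('r, 'm) module" and \<phi> :: "'m \<Rightarrow> 'm"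
    and L :: "('r, 'u) module \<Rightarrow> ennreal"
begin

lemma funpow_hom: "\<phi> ^^ n \<in> rmod_End R M"
proof (induction n)
  case (Suc n)
  then show ?case using closed add smult by (auto simp: rmod_hom_def Pi_iff)
qed (auto simp: rmod_hom_def)

text \<open>With \<open>n\<close> as a parameter, the length formula for images and kernels becomes
  available for every power of \<open>\<phi>\<close>.\<close>

sublocale pow: measured_morphism R M M "\<phi> ^^ n" L for n
  by (intro measured_morphismI M.measured_module_axioms funpow_hom)

lemma submodule_trajectory: "submodule A R M \<Longrightarrow> submodule (trajectory M \<phi> A n) R M"
  by (induction n) (auto intro: M.submodule_zero M.submodule_set_add pow.submodule_image)

lemma trajectory_carrier: "submodule A R M \<Longrightarrow> trajectory M \<phi> A n \<subseteq> carrier M"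
  using submodule_trajectory submoduleD[OF M.right_module_axioms] by blast

lemma trajectory_add:
  assumes A: "submodule A R M"
  shows "trajectory M \<phi> A (m + n) = trajectory M \<phi> A m <+>\<^bsub>M\<^esub> (\<phi> ^^ m) ` trajectory M \<phi> A n"
proof (induction n)
  case 0
  have "x \<oplus>\<^bsub>M\<^esub> \<zero>\<^bsub>M\<^esub> = x" if "x \<in> trajectory M \<phi> A m" for x
    using that subsetD[OF trajectory_carrier[OF A, of m]] by simp
  then show ?case by (auto simp: pow.zero set_add_def')
next
  case (Suc n)
  have c: "(\<phi> ^^ k) ` A \<subseteq> carrier M" "(\<phi> ^^ k) ` trajectory M \<phi> A n \<subseteq> carrier M" for k
    using submoduleD[OF M.right_module_axioms A] trajectory_carrier[OF A] pow.closed by auto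
  have "trajectory M \<phi> A (m + Suc n) =
      trajectory M \<phi> A m <+>\<^bsub>M\<^esub> (\<phi> ^^ m) ` trajectory M \<phi> A n <+>\<^bsub>M\<^esub> (\<phi> ^^ m) ` (\<phi> ^^ n) ` A"
    using Suc by (simp add: funpow_add image_comp)
  also have "\<dots> = trajectory M \<phi> A m <+>\<^bsub>M\<^esub> (\<phi> ^^ m) ` trajectory M \<phi> A (Suc n)"
    using c trajectory_carrier[OF A] c(1)[of "m + n"]
    by (subst M.M.a_set_add_assoc) (auto simp: pow.image_set_add funpow_add image_comp)
  finally show ?case .
qed

lemma trajectory_image_pow:
  assumes A: "submodule A R M"
  shows "trajectory M \<phi> ((\<phi> ^^ k) ` A) n = (\<phi> ^^ k) ` trajectory M \<phi> A n"
  using A hom by (rule pow.trajectory_image) (simp add: funpow_swap1)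

lemma len_trajectory_fin:
  assumes A: "submodule A R M" and fin: "M.len A < \<infinity>"
  shows "M.len (trajectory M \<phi> A n) < \<infinity>"
proof (induction n)
  case (Suc n)
  have "M.len (trajectory M \<phi> A (Suc n)) \<le> M.len (trajectory M \<phi> A n) + M.len ((\<phi> ^^ n) ` A)"
    using submodule_trajectory[OF A] pow.submodule_image[OF A] by (simp add: M.len_set_add_le)
  also have "\<dots> \<le> M.len (trajectory M \<phi> A n) + M.len A"
    by (intro add_left_mono pow.len_image_le A)
  also have "\<dots> < \<infinity>" using Suc fin by simp
  finally show ?case .
qed (simp add: M.len_zero)

text \<open>The image under \<open>\<phi> ^^ m\<close> is retained on the right. Bounding it by the
  trajectory itself gives subadditivity for Fekete's lemma; reading it as a trajectory of the image
  of \<open>A\<close> gives the comparison of entropies below.\<close>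

lemma len_trajectory_add_le:
  assumes A: "submodule A R M"
  shows "M.len (trajectory M \<phi> A (m + n)) \<le>
    M.len (trajectory M \<phi> A m) + M.len ((\<phi> ^^ m) ` trajectory M \<phi> A n)"
  unfolding trajectory_add[OF A]
  by (intro M.len_set_add_le submodule_trajectory pow.submodule_image A)

section \<open>Entropy with respect to a single submodule\<close>

abbreviation "ent_on \<equiv> ent_at (length_at R L) M \<phi>"

lemma ent_on_tendsto_INF:
  assumes A: "submodule A R M" and fin: "M.len A < \<infinity>"
  shows "(\<lambda>n. M.len (trajectory M \<phi> A n) / of_nat n) \<longlonglongrightarrow>
    (INF n\<in>{1..}. M.len (trajectory M \<phi> A n) / of_nat n)"
proof (rule fekete_ennreal)
  show "M.len (trajectory M \<phi> A (m + n)) \<le> M.len (trajectory M \<phi> A m) + M.len (trajectory M \<phi> A n)" for m n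
    using len_trajectory_add_le[OF A, of m n] pow.len_image_le[OF submodule_trajectory[OF A], of m n]
    by (meson add_left_mono order_trans)
qed (rule len_trajectory_fin[OF assms])

lemma ent_on_eq_INF:
  assumes "submodule A R M" "M.len A < \<infinity>"
  shows "ent_on A = (INF n\<in>{1..}. M.len (trajectory M \<phi> A n) / of_nat n)"
  unfolding ent_at_def M.len_def [symmetric] using ent_on_tendsto_INF[OF assms] by (rule limI)

lemma ent_on_tendsto:
  assumes "submodule A R M" "M.len A < \<infinity>"
  shows "(\<lambda>n. M.len (trajectory M \<phi> A n) / of_nat n) \<longlonglongrightarrow> ent_on A"
  unfolding ent_on_eq_INF[OF assms] by (rule ent_on_tendsto_INF[OF assms])

text \<open>The entropy is an infimum, so a lower bound is one condition for each positive
  \<open>n\<close>, here with the denominator cleared.\<close>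

lemma le_ent_on_iff:
  assumes "submodule A R M" "M.len A < \<infinity>"
  shows "c \<le> ent_on A \<longleftrightarrow> (\<forall>n. of_nat n * c \<le> M.len (trajectory M \<phi> A n))"
proof -
  let ?t = "\<lambda>n. M.len (trajectory M \<phi> A n)"
  have "c \<le> x / of_nat n \<longleftrightarrow> of_nat n * c \<le> x" if "1 \<le> n" for n :: nat and x :: ennreal
  proof -
    have canc: "of_nat n * y / of_nat n = y" for y :: ennreal
      using that mult_divide_eq_ennreal[of "of_nat n" y] by (simp add: mult.commute)
    show ?thesis
      using mult_left_mono[of c "x / of_nat n" "of_nat n"] divide_right_mono_ennreal[of "of_nat n * c" x "of_nat n"]
      by (auto simp: canc ennreal_times_divide)
  qed
  \<comment> \<open>The condition at \<open>n = 0\<close> holds trivially, since its left side is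
    0.\<close>
  moreover have "(\<forall>n. of_nat n * c \<le> ?t n) \<longleftrightarrow> (\<forall>n\<in>{1..}. of_nat n * c \<le> ?t n)"
    by (metis atLeast_iff less_one linorder_not_less mult_zero_left of_nat_0 zero_le)
  ultimately show ?thesis by (simp add: ent_on_eq_INF[OF assms] le_INF_iff)
qed

text \<open>The trajectory of \<open>A\<close> of length \<open>n\<close> lies in the one of length
  \<open>k + n\<close>, which is the trajectory of length \<open>k\<close> plus the trajectory of
  the image of length \<open>n\<close>. The first summand has finite length independent of
  \<open>n\<close> and vanishes after division by \<open>n\<close>.\<close>

lemma ent_on_le_ent_on_image:
  assumes A: "submodule A R M" and fin: "M.len A < \<infinity>"
  shows "ent_on A \<le> ent_on ((\<phi> ^^ k) ` A)"
proof -
  let ?B = "(\<phi> ^^ k) ` A"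
  note B = pow.submodule_image[OF A, of k]
  have finB: "M.len ?B < \<infinity>" using pow.len_image_le[OF A, of k] fin by (rule order_le_less_trans)
  have bound: "M.len (trajectory M \<phi> A n) / of_nat n \<le>
      M.len (trajectory M \<phi> A k) / of_nat n + M.len (trajectory M \<phi> ?B n) / of_nat n" for n
  proof -
    have "trajectory M \<phi> A n \<subseteq> trajectory M \<phi> A (n + k)"
      unfolding trajectory_add[OF A]
      by (intro M.set_add_upper1 submodule_trajectory pow.submodule_image A)
    then have "M.len (trajectory M \<phi> A n) \<le> M.len (trajectory M \<phi> A (k + n))"
      by (intro M.len_mono submodule_trajectory A) (simp add: add.commute)
    also have "\<dots> \<le> M.len (trajectory M \<phi> A k) + M.len (trajectory M \<phi> ?B n)"
      using len_trajectory_add_le[OF A, of k n] by (simp add: trajectory_image_pow[OF A])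
    finally show ?thesis
      by (metis divide_right_mono_ennreal add_divide_distrib_ennreal)
  qed
  obtain r where r: "M.len (trajectory M \<phi> A k) = ennreal r"
    using len_trajectory_fin[OF A fin, of k] by (cases "M.len (trajectory M \<phi> A k)") auto
  have "(\<lambda>n. M.len (trajectory M \<phi> A k) / of_nat n + M.len (trajectory M \<phi> ?B n) / of_nat n)
      \<longlonglongrightarrow> 0 + ent_on ?B"
    unfolding r by (intro tendsto_add ennreal_divide_of_nat_tendsto_0 ent_on_tendsto B finB)
  then have "(\<lambda>n. M.len (trajectory M \<phi> A k) / of_nat n + M.len (trajectory M \<phi> ?B n) / of_nat n)
      \<longlonglongrightarrow> ent_on ?B" by simp
  then show ?thesis
    using bound by (intro LIMSEQ_le[OF ent_on_tendsto[OF A fin]]) blast+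
qed

text \<open>Letting the trajectory start at \<open>\<phi>\<^sup>k(A)\<close> does not lower the entropy, and entropies are infima;
  this makes the kernels \<open>Ker(\<phi>\<^sup>k)\<close> negligible uniformly in \<open>k\<close>.\<close>

lemma ent_on_add_kernel_le:
  assumes A: "submodule A R M" and fin: "M.len A < \<infinity>"
  shows "of_nat n * ent_on A + M.len (trajectory M \<phi> A n \<inter> a_kernel M M (\<phi> ^^ k))
    \<le> M.len (trajectory M \<phi> A n)"
proof -
  let ?B = "(\<phi> ^^ k) ` A"
  have "M.len ?B < \<infinity>" using pow.len_image_le[OF A, of k] fin by (rule order_le_less_trans)
  then have "of_nat n * ent_on A \<le> M.len (trajectory M \<phi> ?B n)"
    using le_ent_on_iff[OF pow.submodule_image[OF A]] ent_on_le_ent_on_image[OF assms] by blast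
  also have "trajectory M \<phi> ?B n = (\<phi> ^^ k) ` trajectory M \<phi> A n"
    by (rule trajectory_image_pow[OF A])
  finally show ?thesis
    unfolding pow.len_image_kernel[OF submodule_trajectory[OF A], of n k] by (rule add_right_mono)
qed


text \<open>Replacing \<open>A\<close> by \<open>B\<close> in one summand of a trajectory costs at
  most \<open>e\<close> in length, so a trajectory with \<open>n\<close> summands changes by at most
  \<open>n * e\<close>. Division by \<open>n\<close> leaves \<open>e\<close>.\<close>

lemma ent_on_perturb:
  assumes A: "submodule A R M" and B: "submodule B R M" and "B \<subseteq> A"
    and fin: "M.len A < \<infinity>" and le: "M.len A \<le> M.len B + e"
  shows "ent_on A \<le> ent_on B + e"
proof -
  have finB: "M.len B < \<infinity>" using M.len_mono[OF B A \<open>B \<subseteq> A\<close>] fin by (rule order_le_less_trans)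
  have img: "M.len ((\<phi> ^^ n) ` A) \<le> M.len ((\<phi> ^^ n) ` B) + e" for n
  proof -
    let ?k = "a_kernel M M (\<phi> ^^ n)"
    have Bk: "submodule (B \<inter> ?k) R M" by (intro M.submodule_Int B pow.submodule_kernel)
    \<comment> \<open>Passing from \<open>A\<close> to \<open>B\<close> only shrinks the part inside
      the kernel. Cancelling the finite length of that part for \<open>B\<close> transfers the error
      \<open>e\<close> to the images.\<close>
    have "M.len (B \<inter> ?k) + M.len ((\<phi> ^^ n) ` A) \<le> M.len A"
      unfolding pow.len_image_kernel[OF A, of n] using \<open>B \<subseteq> A\<close>
      by (subst add.commute) (intro add_left_mono M.len_mono Bk M.submodule_Int A pow.submodule_kernel, auto)
    also have "\<dots> \<le> M.len (B \<inter> ?k) + (M.len ((\<phi> ^^ n) ` B) + e)"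
      using le pow.len_image_kernel[OF B, of n] by (simp add: ac_simps)
    finally have "M.len (B \<inter> ?k) + M.len ((\<phi> ^^ n) ` A) \<le> \<dots>" .
    moreover have "M.len (B \<inter> ?k) < \<infinity>"
      using M.len_mono[OF Bk B] finB by (auto intro: order_le_less_trans)
    ultimately show ?thesis by (auto simp: ennreal_add_left_cancel_le)
  qed
  have mono: "trajectory M \<phi> B n \<subseteq> trajectory M \<phi> A n" for n
    using \<open>B \<subseteq> A\<close> by (induction n) (simp_all add: set_add_mono image_mono)
  have traj: "M.len (trajectory M \<phi> A n) \<le> M.len (trajectory M \<phi> B n) + of_nat n * e" for n
  proof (induction n)
    case (Suc n)
    let ?TA = "trajectory M \<phi> A n" and ?TB = "trajectory M \<phi> B n"
    let ?iA = "(\<phi> ^^ n) ` A" and ?iB = "(\<phi> ^^ n) ` B"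
    note sub = submodule_trajectory[OF A, of n] submodule_trajectory[OF B, of n]
      pow.submodule_image[OF A, of n] pow.submodule_image[OF B, of n]
    note car = sub[THEN submoduleD[OF M.right_module_axioms], THEN conjunct1]
    have "M.len (?TA <+>\<^bsub>M\<^esub> ?iA) \<le> M.len (?TB <+>\<^bsub>M\<^esub> ?iA) + of_nat n * e"
      by (rule M.len_set_add_left_le[OF sub(1,2,3) mono Suc len_trajectory_fin[OF B finB]])
    \<comment> \<open>\<open>len_set_add_left_le\<close> exchanges the left summand, so the sum is
      turned around to exchange the newest summand and then turned back.\<close>
    also have "?TB <+>\<^bsub>M\<^esub> ?iA = ?iA <+>\<^bsub>M\<^esub> ?TB"
      by (rule M.M.a_set_add_comm[OF car(2,3)])
    also have "M.len \<dots> \<le> M.len (?iB <+>\<^bsub>M\<^esub> ?TB) + e"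
      using pow.len_image_le[OF B, of n] finB \<open>B \<subseteq> A\<close>
      by (intro M.len_set_add_left_le sub img) (auto intro: order_le_less_trans)
    also have "?iB <+>\<^bsub>M\<^esub> ?TB = ?TB <+>\<^bsub>M\<^esub> ?iB"
      by (rule M.M.a_set_add_comm[OF car(4,2)])
    finally show ?case by (simp add: ring_distribs ac_simps add_right_mono)
  qed (simp add: M.len_zero)
  have "M.len (trajectory M \<phi> A n) / of_nat n \<le> M.len (trajectory M \<phi> B n) / of_nat n + e" if "1 \<le> n" for n
  proof -
    have "M.len (trajectory M \<phi> A n) / of_nat n \<le> M.len (trajectory M \<phi> B n) / of_nat n + of_nat n * e / of_nat n"
      using traj[of n] by (metis divide_right_mono_ennreal add_divide_distrib_ennreal)
    also have "of_nat n * e / of_nat n = e"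
      using that mult_divide_eq_ennreal[of "of_nat n" e] by (simp add: mult.commute)
    finally show ?thesis .
  qed
  then show ?thesis
    by (intro LIMSEQ_le[OF ent_on_tendsto[OF A fin] tendsto_add[OF ent_on_tendsto[OF B finB] tendsto_const]]) blast
qed

end

subsection \<open>The hyperkernel\<close>

context measured_endo
begin

abbreviation "K \<equiv> hyperkernel M \<phi>"

lemma kernel_funpow_mono: "m \<le> n \<Longrightarrow> a_kernel M M (\<phi> ^^ m) \<subseteq> a_kernel M M (\<phi> ^^ n)"
  using pow.zero by (auto simp: a_kernel_def' funpow_add dest!: le_Suc_ex simp flip: add.commute[of _ m])

text \<open>The kernels of the powers form an ascending chain, so finitely many elements of the
  union already lie in one of them. This is how upper continuity is combined with bounds on
  individual kernels.\<close>

lemma finite_subset_hyperkernel: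
  assumes "finite S" "S \<subseteq> K"
  shows "\<exists>k. S \<subseteq> a_kernel M M (\<phi> ^^ k)"
  using assms
proof (induction S)
  case (insert x S)
  then obtain k l where "S \<subseteq> a_kernel M M (\<phi> ^^ k)" "x \<in> a_kernel M M (\<phi> ^^ l)"
    by (auto simp: hyperkernel_def)
  then show ?case
    using kernel_funpow_mono[of k "max k l"] kernel_funpow_mono[of l "max k l"] by (intro exI[of _ "max k l"]) auto
qed simp

lemma submodule_hyperkernel: "submodule K R M"
  unfolding submodule_iff[OF M.right_module_axioms]
proof (intro conjI ballI)
  note ker = submoduleD[OF M.right_module_axioms pow.submodule_kernel]
  show "K \<subseteq> carrier M" by (auto simp: hyperkernel_def a_kernel_def')
  show "\<zero>\<^bsub>M\<^esub> \<in> K" using ker by (auto simp: hyperkernel_def)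
  show "x \<oplus>\<^bsub>M\<^esub> y \<in> K" if xy: "x \<in> K" "y \<in> K" for x y
  proof -
    obtain k where "{x, y} \<subseteq> a_kernel M M (\<phi> ^^ k)"
      using finite_subset_hyperkernel[of "{x, y}"] xy by auto
    then show ?thesis using ker[of k] by (auto simp: hyperkernel_def)
  qed
  show "a \<odot>\<^bsub>M\<^esub> x \<in> K" if "a \<in> carrier R" "x \<in> K" for a x
    using that ker unfolding hyperkernel_def by blast
qed

text \<open>If \<open>\<phi> ^^ n\<close> kills \<open>\<phi> x\<close>, then
  \<open>\<phi> ^^ Suc n\<close> kills \<open>x\<close>; if \<open>\<phi> ^^ n\<close> kills
  \<open>x\<close>, it also kills \<open>\<phi> x\<close>.\<close>

lemma hyperkernel_iff:
  assumes "x \<in> carrier M"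
  shows "\<phi> x \<in> K \<longleftrightarrow> x \<in> K"
proof
  assume "\<phi> x \<in> K"
  then obtain n where "(\<phi> ^^ Suc n) x = \<zero>\<^bsub>M\<^esub>"
    by (auto simp: hyperkernel_def a_kernel_def' funpow_swap1)
  then show "x \<in> K" using assms unfolding hyperkernel_def a_kernel_def' by blast
next
  assume "x \<in> K"
  then obtain n where "(\<phi> ^^ n) x = \<zero>\<^bsub>M\<^esub>" by (auto simp: hyperkernel_def a_kernel_def')
  then have "(\<phi> ^^ n) (\<phi> x) = \<zero>\<^bsub>M\<^esub>" using zero by (simp flip: funpow_swap1)
  then show "\<phi> x \<in> K" using closed[OF assms] by (auto simp: hyperkernel_def a_kernel_def')
qed

section \<open>The induced map on the quotient by the hyperkernel and its entropy\<close>

sublocale proj: measured_morphism R M "quot M K" "\<lambda>x. K +>\<^bsub>M\<^esub> x" L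
  using submodule_hyperkernel by (rule M.measured_coset)

text \<open>From right to left this is well-definedness of the induced map, from left to right its
  injectivity. Both come from \<open>hyperkernel_iff\<close> applied to the difference.\<close>

lemma coset_hyperkernel_image_iff:
  assumes "x \<in> carrier M" "y \<in> carrier M"
  shows "K +>\<^bsub>M\<^esub> \<phi> x = K +>\<^bsub>M\<^esub> \<phi> y \<longleftrightarrow> K +>\<^bsub>M\<^esub> x = K +>\<^bsub>M\<^esub> y"
  using assms hyperkernel_iff[of "x \<ominus>\<^bsub>M\<^esub> y"]
  by (simp add: M.coset_eq_iff[OF submodule_hyperkernel] closed minus)

text \<open>\<open>induced\<close> takes a union over all representatives of a coset; by
  well-definedness every member of that union is the same coset.\<close>

lemma induced_coset:
  assumes x: "x \<in> carrier M"
  shows "induced M K \<phi> (K +>\<^bsub>M\<^esub> x) = K +>\<^bsub>M\<^esub> \<phi> x"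
proof -
  have K: "subgroup K (add_monoid M)" using submodule_hyperkernel by (rule submodule.axioms)
  have "K +>\<^bsub>M\<^esub> \<phi> y = K +>\<^bsub>M\<^esub> \<phi> x" if y: "y \<in> K +>\<^bsub>M\<^esub> x" for y
  proof -
    have "y \<in> carrier M"
      using y x subgroup.subset[OF K] by (auto simp: a_r_coset_def')
    moreover have "K +>\<^bsub>M\<^esub> x = K +>\<^bsub>M\<^esub> y"
      using M.M.add.repr_independence[OF _ _ K, of y x] y x by (simp add: a_r_coset_def)
    ultimately show ?thesis using coset_hyperkernel_image_iff x by metis
  qed
  moreover have "x \<in> K +>\<^bsub>M\<^esub> x"
    using M.M.add.rcos_self[OF _ K] x by (simp add: a_r_coset_def)
  ultimately show ?thesis unfolding induced_def by blast
qed

lemma carrier_quot: "carrier (quot M K) = (\<lambda>x. K +>\<^bsub>M\<^esub> x) ` carrier M"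
  by (auto simp: quot_def A_RCOSETS_def')

lemma inj_on_induced: "inj_on (induced M K \<phi>) (carrier (quot M K))"
  by (auto simp: carrier_quot inj_on_def induced_coset coset_hyperkernel_image_iff)

lemma induced_hom: "induced M K \<phi> \<in> rmod_End R (quot M K)"
  by (auto simp: rmod_hom_def carrier_quot induced_coset closed add smult M.smult_closed
      simp flip: proj.add proj.smult)

interpretation quot: measured_endo R "quot M K" "induced M K \<phi>" L
  unfolding measured_endo_def
  by (intro measured_morphismI proj.N.measured_module_axioms induced_hom)

lemma trajectory_quot:
  "submodule A R M \<Longrightarrow>
    trajectory (quot M K) (induced M K \<phi>) ((\<lambda>x. K +>\<^bsub>M\<^esub> x) ` A) n = (\<lambda>x. K +>\<^bsub>M\<^esub> x) ` trajectory M \<phi> A n"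
  by (rule proj.trajectory_image[OF _ hom]) (simp_all add: induced_coset)

text \<open>Projection does not increase lengths, which gives one inequality. For the other,
  \<open>le_ent_on_iff\<close> reduces the claim to a bound for each trajectory, obtained by passing
  from \<open>ent_on_add_kernel_le\<close> to the whole hyperkernel.\<close>

lemma ent_on_quot:
  assumes A: "submodule A R M" and fin: "M.len A < \<infinity>"
  shows "quot.ent_on ((\<lambda>x. K +>\<^bsub>M\<^esub> x) ` A) = ent_on A"
proof -
  let ?A = "(\<lambda>x. K +>\<^bsub>M\<^esub> x) ` A"
  note A' = proj.submodule_image[OF A]
  have fin': "proj.N.len ?A < \<infinity>" using proj.len_image_le[OF A] fin by (rule order_le_less_trans)
  have "of_nat n * ent_on A \<le> proj.N.len (trajectory (quot M K) (induced M K \<phi>) ?A n)" for n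
  proof -
    let ?T = "trajectory M \<phi> A n"
    note T = submodule_trajectory[OF A, of n]
    have TK: "submodule (?T \<inter> K) R M" by (intro M.submodule_Int T submodule_hyperkernel)
    have finT: "M.len ?T < \<infinity>" by (rule len_trajectory_fin[OF A fin])
    have finTK: "M.len (?T \<inter> K) < \<infinity>"
      using M.len_mono[OF TK T] finT by (auto intro: order_le_less_trans)
    have "of_nat n * ent_on A + M.len (?T \<inter> K) \<le> M.len ?T"
    proof (rule ennreal_le_epsilon)
      fix e :: real assume "0 < e"
      then obtain S where S: "finite S" "S \<subseteq> ?T \<inter> K" and le: "M.len (?T \<inter> K) \<le> M.len (rspan R M S) + ennreal e"
        using M.len_approx_rspan_add[OF TK finTK, of "ennreal e"] by auto
      \<comment> \<open>The finite set \<open>S\<close> generates \<open>?T \<inter> K\<close> up to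
        length \<open>e\<close>. A single kernel contains \<open>S\<close>, and hence its
        span.\<close>
      obtain k where "S \<subseteq> a_kernel M M (\<phi> ^^ k)" using finite_subset_hyperkernel S by (metis le_inf_iff)
      then have "S \<subseteq> ?T \<inter> a_kernel M M (\<phi> ^^ k)" using S by auto
      moreover have Tk: "submodule (?T \<inter> a_kernel M M (\<phi> ^^ k)) R M"
        by (intro M.submodule_Int T pow.submodule_kernel)
      moreover have "S \<subseteq> carrier M" using S submoduleD[OF M.right_module_axioms T] by auto
      ultimately have "M.len (rspan R M S) \<le> M.len (?T \<inter> a_kernel M M (\<phi> ^^ k))"
        by (intro M.len_mono M.submodule_rspan rspan_least)
      with le have "M.len (?T \<inter> K) \<le> M.len (?T \<inter> a_kernel M M (\<phi> ^^ k)) + ennreal e"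
        by (meson add_right_mono order_trans)
      then have "of_nat n * ent_on A + M.len (?T \<inter> K) \<le>
          of_nat n * ent_on A + M.len (?T \<inter> a_kernel M M (\<phi> ^^ k)) + ennreal e"
        unfolding add.assoc by (rule add_left_mono)
      also have "\<dots> \<le> M.len ?T + ennreal e"
        by (intro add_right_mono ent_on_add_kernel_le A fin)
      finally show "of_nat n * ent_on A + M.len (?T \<inter> K) \<le> M.len ?T + ennreal e" .
    qed
    \<comment> \<open>The projection has kernel \<open>K\<close>, so the length of \<open>?T\<close>
      splits. Cancelling the finite length of \<open>?T \<inter> K\<close> leaves the projected
      trajectory.\<close>
    also have "M.len ?T = proj.N.len ((\<lambda>x. K +>\<^bsub>M\<^esub> x) ` ?T) + M.len (?T \<inter> K)"
      using proj.len_image_kernel[OF T] M.kernel_coset[OF submodule_hyperkernel] by simp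
    finally show ?thesis
      using finTK by (auto simp: trajectory_quot[OF A] ennreal_add_left_cancel_le add.commute[of _ "M.len (?T \<inter> K)"])
  qed
  then have "ent_on A \<le> quot.ent_on ?A" by (simp add: quot.le_ent_on_iff[OF A' fin'])
  moreover have "quot.ent_on ?A \<le> ent_on A"
    unfolding quot.ent_on_eq_INF[OF A' fin'] ent_on_eq_INF[OF A fin] trajectory_quot[OF A]
    by (intro INF_mono' divide_right_mono_ennreal proj.len_image_le submodule_trajectory A)
  ultimately show ?thesis by (rule antisym[rotated])
qed

text \<open>Projecting an \<open>L\<close>-finite submodule keeps it \<open>L\<close>-finite with
  the same entropy, which bounds the entropy of \<open>M\<close>. Conversely, an
  \<open>L\<close>-finite submodule of the quotient need not be the image of an
  \<open>L\<close>-finite one, so it is approximated from inside up to \<open>e\<close>.\<close>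

lemma ent_quot:
  assumes lf: "locally_finite R (length_at R L) M"
  shows "ent R (length_at R L) (quot M K) (induced M K \<phi>) = ent R (length_at R L) M \<phi>"
    (is "?Q = ?M")
proof (rule antisym)
  let ?p = "\<lambda>x. K +>\<^bsub>M\<^esub> x"
  show "?M \<le> ?Q"
    unfolding ent_def
  proof (rule SUP_mono)
    fix A assume "A \<in> Fin_sub R (length_at R L) M"
    then have A: "submodule A R M" "M.len A < \<infinity>" by (simp_all add: M.Fin_sub_iff)
    then have "?p ` A \<in> Fin_sub R (length_at R L) (quot M K)"
      using proj.submodule_image proj.len_image_le[OF A(1)] by (auto simp: proj.N.Fin_sub_iff intro: order_le_less_trans)
    then show "\<exists>B\<in>Fin_sub R (length_at R L) (quot M K). ent_on A \<le> quot.ent_on B"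
      using ent_on_quot[OF A] by (intro bexI[of _ "?p ` A"]) simp_all
  qed
  show "?Q \<le> ?M"
    unfolding ent_def[of R _ "quot M K"]
  proof (rule SUP_least)
    fix B assume "B \<in> Fin_sub R (length_at R L) (quot M K)"
    then have B: "submodule B R (quot M K)" and finB: "proj.N.len B < \<infinity>"
      by (simp_all add: proj.N.Fin_sub_iff)
    show "quot.ent_on B \<le> ?M"
    proof (rule ennreal_le_epsilon)
      fix e :: real assume "0 < e"
      then obtain S' where S': "finite S'" "S' \<subseteq> B"
        and le: "proj.N.len B \<le> proj.N.len (rspan R (quot M K) S') + ennreal e"
        using proj.N.len_approx_rspan_add[OF B finB, of "ennreal e"] by auto
      have "S' \<subseteq> ?p ` carrier M"
        using S' submoduleD[OF proj.N.right_module_axioms B] by (auto simp: carrier_quot)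
      \<comment> \<open>The finitely many generators are lifted to \<open>M\<close>; their span
        \<open>?F\<close> has finite length because \<open>M\<close> is locally finite.\<close>
      then obtain S where S: "finite S" "S \<subseteq> carrier M" "S' = ?p ` S"
        using S'(1) finite_subset_image by metis
      let ?F = "rspan R M S"
      have F: "submodule ?F R M" using S(2) by (rule M.submodule_rspan)
      have finF: "M.len ?F < \<infinity>"
        using lf S by (auto simp: locally_finite_def fg_submodules_def M.len_def)
      note pF = proj.submodule_image[OF F]
      have "?F \<subseteq> {x \<in> carrier M. ?p x \<in> B}"
        using S S'(2) by (intro rspan_least proj.submodule_vimage B) auto
      then have pFB: "?p ` ?F \<subseteq> B" by auto
      have "rspan R (quot M K) S' \<subseteq> ?p ` ?F"
        unfolding S(3) by (intro rspan_least pF image_mono rspan_superset)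
      moreover have "submodule (rspan R (quot M K) S') R (quot M K)"
        using \<open>S' \<subseteq> ?p ` carrier M\<close> by (intro proj.N.submodule_rspan) (simp add: carrier_quot)
      \<comment> \<open>The image of \<open>?F\<close> lies between the span of \<open>S'\<close>
        and \<open>B\<close>, so it too approximates \<open>B\<close> up to
        \<open>e\<close>.\<close>
      ultimately have "proj.N.len B \<le> proj.N.len (?p ` ?F) + ennreal e"
        using le proj.N.len_mono[OF _ pF] by (meson add_right_mono order_trans)
      then have "quot.ent_on B \<le> quot.ent_on (?p ` ?F) + ennreal e"
        by (rule quot.ent_on_perturb[OF B pF pFB finB])
      also have "\<dots> = ent_on ?F + ennreal e" by (simp add: ent_on_quot[OF F finF])
      also have "\<dots> \<le> ?M + ennreal e"
        unfolding ent_def using F finF by (intro add_right_mono SUP_upper) (simp add: M.Fin_sub_iff)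
      finally show "quot.ent_on B \<le> ?M + ennreal e" .
    qed
  qed
qed

end

section \<open>Return from \<open>length_at R L\<close> to \<open>L\<close> on the original
  module\<close>

theorem proposition5p5:
  fixes R :: "'r ring"
    and L :: "('r, 'u) module \<Rightarrow> ennreal"
    and M :: "('r, 'u) module"
    and \<phi> :: "'u \<Rightarrow> 'u"
  defines "K \<equiv> hyperkernel M \<phi>"
  assumes "ring R"
    and "length_function R L"
    and "(M, \<phi>) \<in> lFinX R L"
  shows "inj_on (induced M K \<phi>) (carrier (quot M K)) \<and>
    ent R L M \<phi> = ent R (length_at R L) (quot M K) (induced M K \<phi>)"
proof -
  have M: "right_module R M" and \<phi>: "\<phi> \<in> rmod_End R M" and lf: "locally_finite R L M"
    using assms(4) by (auto simp: lFinX_def)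
  \<comment> \<open>Since \<open>M\<close> already has elements of type \<open>'u\<close>, the
    identity serves as the required embedding.\<close>
  have "measured_module R M L"
    using M assms(3) by (auto simp: measured_module_def measured_module_axioms_def intro: inj_on_id)
  then interpret measured_endo R M \<phi> L
    using \<phi> by (auto simp: measured_endo_def intro: measured_morphismI)
  \<comment> \<open>A submodule of \<open>M\<close> is its own copy over \<open>'u\<close>, through
    the identity isomorphism. Hence local finiteness, the finite submodules and the entropies are
    the same for \<open>length_at R L\<close> as for \<open>L\<close>.\<close>
  have L: "length_at R L (sub_of M A) = L (sub_of M A)" if "submodule A R M" for A
  proof (rule length_at_eq[OF assms(3) M.sub_right_module[OF that]])
    show "rmod_iso R (sub_of M A) (sub_of M A)"
      unfolding rmod_iso_def by (intro bexI[of _ "\<lambda>x. x"]) (auto simp: rmod_hom_def bij_betw_def)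
  qed
  have "locally_finite R (length_at R L) M"
    using lf by (auto simp: locally_finite_def fg_submodules_def L M.submodule_rspan)
  moreover have "Fin_sub R (length_at R L) M = Fin_sub R L M"
    by (auto simp: Fin_sub_def L)
  moreover have "ent_on A = ent_at L M \<phi> A" if "A \<in> Fin_sub R L M" for A
    using that by (simp add: ent_at_def Fin_sub_def L submodule_trajectory)
  ultimately show ?thesis
    using ent_quot inj_on_induced unfolding K_def ent_def by simp
qed

end
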